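(* Let $\pi_{\mathbf{d},\mathbf{m}}$ denote the joint density of $(\mathbf{d},\mathbf{m})$ induced by the accurate model $\mathbf{d}=\mathbf{F}(\mathbf{m})+\mathbf{e}$ with Gaussian prior $\pi_{\mathbf{m}}=\mathcal{N}(\overline{\mathbf{m}},\mathbf{\Gamma}_{\mathbf{m}\mathbf{m}})$, let $\pi^{\mathbf{O}}_{\mathbf{d},\mathbf{m}}$ denote the joint density induced by the pure-BAE global linear model (both models are described in the context), and assume that $\pi_{\mathbf{d},\mathbf{m}}$ has finite differential entropy. Define the exact and pure-BAE expected information gains $$\Psi=\mathbb{E}_{\pi_{\mathbf{d}}}\big[\mathcal{D}_{\mathrm{KL}}(\pi_{\mathbf{m}\vert\mathbf{d}}\,\|\,\pi_{\mathbf{m}})\big],\qquad \Psi^{\mathbf{O}}=\mathbb{E}_{\pi^{\mathbf{O}}_{\mathbf{d}}}\big[\mathcal{D}_{\mathrm{KL}}(\pi^{\mathbf{O}}_{\mathbf{m}\vert\mathbf{d}}\,\|\,\pi^{\mathbf{O}}_{\mathbf{m}})\big].$$ Then $$\Psi\ \ge\ \Psi^{\mathbf{O}}.$$ Furthermore, $$\Psi-\Psi^{\mathbf{O}}=\mathbb{E}_{\pi_{\mathbf{d}}}\big[\mathcal{D}_{\mathrm{KL}}(\pi_{\mathbf{m}\vert\mathbf{d}}\,\|\,\pi^{\mathbf{O}}_{\mathbf{m}\vert\mathbf{d}})\big].$$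
   Context: Accurate model: $\mathbf{d}=\mathbf{F}(\mathbf{m})+\mathbf{e}$, where $\mathbf{F}:\mathbb{R}^n\to\mathbb{R}^d$ is a (possibly nonlinear) map that is square-integrable with respect to the prior, $\mathbf{m}\sim\mathcal{N}(\overline{\mathbf{m}},\mathbf{\Gamma}_{\mathbf{m}\mathbf{m}})$, $\mathbf{e}\sim\mathcal{N}(\overline{\mathbf{e}},\mathbf{\Gamma}_{\mathbf{e}})$, $\mathbf{m}$ and $\mathbf{e}$ are independent, and $\mathbf{\Gamma}_{\mathbf{m}\mathbf{m}}$, $\mathbf{\Gamma}_{\mathbf{e}}$ are symmetric positive definite. Set $\overline{\mathbf{F}}=\mathbb{E}_{\pi_{\mathbf{m}}}[\mathbf{F}(\mathbf{m})]$, $\mathbf{\Gamma}_{\mathbf{F}\mathbf{F}}=\mathrm{Cov}(\mathbf{F}(\mathbf{m}),\mathbf{F}(\mathbf{m}))$, $\mathbf{\Gamma}_{\mathbf{F}\mathbf{m}}=\mathrm{Cov}(\mathbf{F}(\mathbf{m}),\mathbf{m})$. Pure-BAE global linear model: $\mathbf{d}=\mathbf{F}_{\mathbf{O}}\mathbf{m}+\widetilde{\boldsymbol{\eta}}$, where $\mathbf{m}\sim\mathcal{N}(\overline{\mathbf{m}},\mathbf{\Gamma}_{\mathbf{m}\mathbf{m}})$ and $\widetilde{\boldsymbol{\eta}}\sim\mathcal{N}(\overline{\boldsymbol{\eta}},\mathbf{\Gamma}_{\boldsymbol{\eta}\vert\mathbf{m}})$ are independent, with $$\mathbf{F}_{\mathbf{O}}=\mathbf{\Gamma}_{\mathbf{F}\mathbf{m}}\mathbf{\Gamma}_{\mathbf{m}\mathbf{m}}^{-1},\quad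 \overline{\boldsymbol{\eta}}=\overline{\mathbf{F}}-\mathbf{F}_{\mathbf{O}}\overline{\mathbf{m}}+\overline{\mathbf{e}},\quad \mathbf{\Gamma}_{\boldsymbol{\eta}\vert\mathbf{m}}=\mathbf{\Gamma}_{\mathbf{e}}+\mathbf{\Gamma}_{\mathbf{F}\mathbf{F}}-\mathbf{\Gamma}_{\mathbf{F}\mathbf{m}}\mathbf{\Gamma}_{\mathbf{m}\mathbf{m}}^{-1}\mathbf{\Gamma}_{\mathbf{F}\mathbf{m}}^\top.$$ For the joint density $\pi_{\mathbf{d},\mathbf{m}}$ (resp. $\pi^{\mathbf{O}}_{\mathbf{d},\mathbf{m}}$), the symbols $\pi_{\mathbf{d}},\pi_{\mathbf{m}},\pi_{\mathbf{m}\vert\mathbf{d}}$ (resp. $\pi^{\mathbf{O}}_{\mathbf{d}},\pi^{\mathbf{O}}_{\mathbf{m}},\pi^{\mathbf{O}}_{\mathbf{m}\vert\mathbf{d}}$) denote its marginals and its conditional (posterior) density. The differential entropy of a density $\pi$ is $h(\pi)=-\mathbb{E}_\pi[\log\pi(\mathbf{x})]$, and $\mathcal{D}_{\mathrm{KL}}(\pi\|p)=\mathbb{E}_\pi[\log(\pi/p)]$. *)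

theory Defs
  imports "HOL-Probability.Probability"
begin

definition spd :: "real^'n^'n \<Rightarrow> bool" where
  "spd A \<longleftrightarrow> transpose A = A \<and> (\<forall>x. x \<noteq> 0 \<longrightarrow> x \<bullet> (A *v x) > 0)"

text \<open>The Gaussian density and measure are meaningful only for symmetric positive definite
  covariance matrices.\<close>

definition gauss_density :: "real^'n \<Rightarrow> real^'n^'n \<Rightarrow> real^'n \<Rightarrow> real" where
  "gauss_density \<mu> \<Gamma> x =
     exp (- (1/2) * ((x - \<mu>) \<bullet> (matrix_inv \<Gamma> *v (x - \<mu>)))) / sqrt ((2 * pi) ^ CARD('n) * det \<Gamma>)"

definition gauss :: "real^'n \<Rightarrow> real^'n^'n \<Rightarrow> (real^'n) measure" where
  "gauss \<mu> \<Gamma> = density lborel (gauss_density \<mu> \<Gamma>)"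

definition cross_cov :: "'w measure \<Rightarrow> ('w \<Rightarrow> real^'a) \<Rightarrow> ('w \<Rightarrow> real^'b) \<Rightarrow> real^'b^'a" where
  "cross_cov M X Y =
     (\<chi> i j. \<integral>w. (X w - (\<integral>v. X v \<partial>M)) $ i * (Y w - (\<integral>v. Y v \<partial>M)) $ j \<partial>M)"

text \<open>Independence of two random variables. The library's \<open>indep_var\<close> is not used because it requires
  both to take values in the same type. The preimage families are already sigma-algebras.\<close>

definition indep_rv ::
  "'w measure \<Rightarrow> ('w \<Rightarrow> 'a::topological_space) \<Rightarrow> ('w \<Rightarrow> 'b::topological_space) \<Rightarrow> bool" where
  "indep_rv M X Y \<longleftrightarrow>
     prob_space.indep_set M {X -` A \<inter> space M |A. A \<in> sets borel} {Y -` B \<inter> space M |B. B \<in> sets borel}"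

text \<open>Here \<open>F\<close> is the forward map, \<open>mb\<close> and \<open>Gm\<close> are the mean and covariance of the prior, \<open>eb\<close> and
  \<open>Ge\<close> those of the noise.\<close>

definition bae_op :: "(real^'n \<Rightarrow> real^'k) \<Rightarrow> real^'n \<Rightarrow> real^'n^'n \<Rightarrow> real^'n^'k" where
  "bae_op F mb Gm = cross_cov (gauss mb Gm) F (\<lambda>x. x) ** matrix_inv Gm"

definition bae_mean ::
  "(real^'n \<Rightarrow> real^'k) \<Rightarrow> real^'n \<Rightarrow> real^'n^'n \<Rightarrow> real^'k \<Rightarrow> real^'k" where
  "bae_mean F mb Gm eb = (\<integral>x. F x \<partial>gauss mb Gm) - bae_op F mb Gm *v mb + eb"

definition bae_cov ::
  "(real^'n \<Rightarrow> real^'k) \<Rightarrow> real^'n \<Rightarrow> real^'n^'n \<Rightarrow> real^'k^'k \<Rightarrow> real^'k^'k" where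
  "bae_cov F mb Gm Ge =
     Ge + cross_cov (gauss mb Gm) F F
      - cross_cov (gauss mb Gm) F (\<lambda>x. x) ** matrix_inv Gm
          ** transpose (cross_cov (gauss mb Gm) F (\<lambda>x. x))"

text \<open>A joint density \<open>p\<close> takes the data as first and the parameter as second component.\<close>

definition data_marginal :: "('d::euclidean_space \<times> 'p::euclidean_space \<Rightarrow> real) \<Rightarrow> 'd \<Rightarrow> real" where
  "data_marginal p d = (\<integral>m. p (d, m) \<partial>lborel)"

definition param_marginal :: "('d::euclidean_space \<times> 'p::euclidean_space \<Rightarrow> real) \<Rightarrow> 'p \<Rightarrow> real" where
  "param_marginal p m = (\<integral>d. p (d, m) \<partial>lborel)"

definition posterior ::
  "('d::euclidean_space \<times> 'p::euclidean_space \<Rightarrow> real) \<Rightarrow> 'd \<Rightarrow> 'p \<Rightarrow> real" where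
  "posterior p d m = p (d, m) / data_marginal p d"

text \<open>\<open>KL_divergence\<close> takes the reference measure first, so this is the divergence of \<open>p\<close> from \<open>q\<close>,
  \<open>E\<^sub>p [ln (p / q)]\<close>, with natural logarithm.\<close>

definition KL_dens :: "('a::euclidean_space \<Rightarrow> real) \<Rightarrow> ('a \<Rightarrow> real) \<Rightarrow> real" where
  "KL_dens p q = KL_divergence (exp 1) (density lborel q) (density lborel p)"

definition expected_information_gain ::
  "('d::euclidean_space \<times> 'p::euclidean_space \<Rightarrow> real) \<Rightarrow> real" where
  "expected_information_gain p =
     (\<integral>d. KL_dens (posterior p d) (param_marginal p) \<partial>density lborel (data_marginal p))"

end

theory Submission
  imports Defs "HOL-Real_Asymp.Real_Asymp"
begin

text \<open>Write \<open>q\<close> for the joint density \<open>p\<^sub>O\<close> of the linear model, \<open>p\<^sub>d\<close> and \<open>q\<^sub>d\<close> for the data marginals and \<open>\<pi>\<close>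
  for the common prior density. Both expected information gains are mutual informations,
  \<open>\<Psi> = E\<^sub>p [ln (p / (p\<^sub>d \<pi>))]\<close> and \<open>\<Psi>\<^sub>O = E\<^sub>q [ln (q / (q\<^sub>d \<pi>))]\<close>.

  The linear model is Gaussian, so \<open>ln (q / (q\<^sub>d \<pi>))\<close> is a quadratic polynomial in \<open>(d, m)\<close>. Its operator, mean
  and covariance are chosen so that data and parameter have the same first and second moments as in the
  accurate model (\<open>accurate_model_second_moments\<close>, \<open>linear_model_second_moments\<close>). A quadratic polynomial does
  not distinguish two laws with equal moments, whence \<open>\<Psi>\<^sub>O = E\<^sub>p [ln (q / (q\<^sub>d \<pi>))]\<close> and
  \<open>\<Psi> - \<Psi>\<^sub>O = E\<^sub>p [ln ((p / p\<^sub>d) / (q / q\<^sub>d))]\<close>. This is the expected divergence of the posteriors and is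
  nonnegative by Gibbs' inequality (\<open>information_gain_difference\<close>).

  The analytic work is to justify these manipulations. The moments of a Gaussian density come from its behaviour
  under translations (\<open>gauss_mgf\<close>), as does the Gaussian shape of the data marginal \<open>q\<^sub>d\<close>
  (\<open>gaussian_data_marginal\<close>). Integrability of the integrand of \<open>\<Psi>\<close> rests on the finite entropy of \<open>p\<close>:
  adding the integrand of the divergence of \<open>p\<^sub>d\<close> from \<open>q\<^sub>d\<close> gives \<open>p (ln p - ln \<pi> - ln q\<^sub>d)\<close>, which is
  integrable as \<open>ln \<pi>\<close> and \<open>ln q\<^sub>d\<close> are quadratic, and both summands are bounded below by integrable
  functions.\<close>

section \<open>Symmetric positive definite matrices\<close>

lemma inner_matrix_adjoint: "x \<bullet> (A *v y) = (transpose A *v x) \<bullet> (y :: real^'a)"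
  for A :: "real^'a^'b"
  by (simp add: dot_lmul_matrix transpose_matrix_vector)

lemma spd_sym: "spd A \<Longrightarrow> x \<bullet> (A *v y) = y \<bullet> (A *v x)"
  by (metis spd_def inner_matrix_adjoint inner_commute)

lemma spd_invertible:
  fixes A :: "real^'a^'a"
  assumes "spd A" shows "invertible A"
proof -
  have "x = 0" if "A *v x = 0" for x
    using assms that unfolding spd_def by (metis inner_zero_right less_irrefl)
  then show ?thesis
    unfolding invertible_left_inverse matrix_left_invertible_ker by blast
qed

lemma spd_matrix_inv:
  fixes A :: "real^'a^'a"
  assumes "spd A" shows "A ** matrix_inv A = mat 1" "matrix_inv A ** A = mat 1"
  using someI_ex[of "\<lambda>A'. A ** A' = mat 1 \<and> A' ** A = mat 1"] spd_invertible[OF assms]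
  unfolding invertible_def matrix_inv_def by blast+

lemma spd_inv_cancel:
  fixes A :: "real^'a^'a"
  assumes "spd A" shows "A *v (matrix_inv A *v x) = x" "matrix_inv A *v (A *v x) = x"
  by (simp_all add: matrix_vector_mul_assoc spd_matrix_inv[OF assms])

lemma spd_inv:
  fixes A :: "real^'a^'a"
  assumes "spd A" shows "spd (matrix_inv A)"
proof -
  have t: "transpose A = A" using assms by (simp add: spd_def)
  have "transpose (matrix_inv A) = transpose (matrix_inv A) ** (A ** matrix_inv A)"
    by (simp add: spd_matrix_inv[OF assms])
  also have "\<dots> = transpose (A ** matrix_inv A) ** matrix_inv A"
    by (simp add: matrix_mul_assoc matrix_transpose_mul t)
  finally have "transpose (matrix_inv A) = matrix_inv A"
    by (simp add: spd_matrix_inv[OF assms] transpose_mat)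
  moreover have "x \<bullet> (matrix_inv A *v x) > 0" if "x \<noteq> 0" for x
  proof -
    define y where "y = matrix_inv A *v x"
    have x: "x = A *v y" by (simp add: y_def spd_inv_cancel[OF assms])
    then have "y \<noteq> 0" using that by (metis matrix_vector_mult_0_right)
    then have "0 < y \<bullet> (A *v y)" using assms by (simp add: spd_def)
    then show ?thesis
      unfolding y_def[symmetric] x[symmetric] by (simp add: inner_commute)
  qed
  ultimately show ?thesis by (simp add: spd_def)
qed

lemma borel_measurable_matrix_vector[measurable]:
  fixes A :: "real^'a^'b"
  shows "f \<in> borel_measurable M \<Longrightarrow> (\<lambda>x. A *v f x) \<in> borel_measurable M"
  by (rule borel_measurable_continuous_on) (auto intro!: linear_continuous_on matrix_vector_mul_bounded_linear)

lemma borel_measurable_gauss_density[measurable]: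
  fixes \<mu> :: "real^'n"
  shows "gauss_density \<mu> \<Gamma> \<in> borel_measurable borel"
  unfolding gauss_density_def[abs_def] by measurable

section \<open>Moments of Gaussian measures\<close>

text \<open>If the determinant were not positive, the density would nowhere be positive, which total mass one
excludes.\<close>

lemma gauss_density_pos:
  assumes "prob_space (gauss \<mu> \<Gamma>)"
  shows "0 < gauss_density \<mu> \<Gamma> x"
proof (rule ccontr)
  assume "\<not> ?thesis"
  then have "sqrt ((2 * pi) ^ CARD('a) * det \<Gamma>) \<le> 0"
    unfolding gauss_density_def by (metis divide_pos_pos exp_gt_zero not_le)
  then have "gauss_density \<mu> \<Gamma> y \<le> 0" for y
    unfolding gauss_density_def by (simp add: divide_nonneg_nonpos del: real_sqrt_le_0_iff)
  then have "gauss \<mu> \<Gamma> = null_measure lborel"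
    by (simp add: gauss_def ennreal_neg null_measure_eq_density)
  then show False
    using prob_space.emeasure_space_1[OF assms] by simp
qed

lemma lborel_has_bochner_integral_translate:
  fixes f :: "'a::euclidean_space \<Rightarrow> real"
  assumes "has_bochner_integral lborel f I"
  shows "has_bochner_integral lborel (\<lambda>x. f (x + a)) I"
proof -
  have [measurable]: "f \<in> borel_measurable borel"
    using borel_measurable_has_bochner_integral[OF assms] by simp
  have "integrable (distr lborel borel ((+) a)) f" "integral\<^sup>L (distr lborel borel ((+) a)) f = I"
    using assms by (simp_all add: lborel_distr_plus has_bochner_integral_iff)
  then show ?thesis
    by (simp add: integrable_distr_eq integral_distr has_bochner_integral_iff add.commute)
qed

text \<open>Translation invariance of Lebesgue measure yields the exponential moments: shifting the density by
\<open>\<Gamma> *v k\<close> multiplies it by \<open>exp (k \<bullet> (x - \<mu>))\<close> and by a constant, and the shifted density still has mass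
one.\<close>

lemma gauss_mgf:
  fixes \<mu> k :: "real^'n"
  assumes spd: "spd \<Gamma>" and P: "prob_space (gauss \<mu> \<Gamma>)"
  shows "has_bochner_integral (gauss \<mu> \<Gamma>) (\<lambda>x. exp (k \<bullet> (x - \<mu>))) (exp (k \<bullet> (\<Gamma> *v k) / 2))"
proof -
  define g where "g = gauss_density \<mu> \<Gamma>"
  have pos: "0 < g x" for x using gauss_density_pos[OF P] by (simp add: g_def)
  have [measurable]: "g \<in> borel_measurable borel" by (simp add: g_def)
  have "has_bochner_integral (gauss \<mu> \<Gamma>) (\<lambda>x. 1::real) 1"
    using prob_space.prob_space[OF P] finite_measure.integrable_const[OF prob_space.finite_measure[OF P], of "1::real"]
    by (simp add: has_bochner_integral_iff)
  then have "has_bochner_integral lborel g 1"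
    unfolding gauss_def g_def[symmetric]
    using integrable_density[of "\<lambda>x. 1::real" lborel g] integral_density[of "\<lambda>x. 1::real" lborel g]
    by (simp add: has_bochner_integral_iff less_imp_le[OF pos])
  from lborel_has_bochner_integral_translate[OF this, of "- (\<Gamma> *v k)"]
  have I: "has_bochner_integral lborel (\<lambda>x. exp (k \<bullet> (\<Gamma> *v k) / 2) * g (x - \<Gamma> *v k)) (exp (k \<bullet> (\<Gamma> *v k) / 2))"
    using has_bochner_integral_mult_right[of "exp (k \<bullet> (\<Gamma> *v k) / 2)" lborel _ 1] by force
  have eq: "exp (k \<bullet> (\<Gamma> *v k) / 2) * g (x - \<Gamma> *v k) = g x * exp (k \<bullet> (x - \<mu>))" for x
  proof -
    define y where "y = x - \<mu>"
    let ?A = "matrix_inv \<Gamma>"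
    have "(x - \<Gamma> *v k - \<mu>) \<bullet> (?A *v (x - \<Gamma> *v k - \<mu>)) = (y - \<Gamma> *v k) \<bullet> (?A *v y - k)"
      by (simp add: y_def matrix_vector_mult_diff_distrib spd_inv_cancel[OF spd] algebra_simps)
    also have "\<dots> = y \<bullet> (?A *v y) - 2 * (k \<bullet> y) + k \<bullet> (\<Gamma> *v k)"
      using spd_sym[OF spd_inv[OF spd], of "\<Gamma> *v k" y]
      by (simp add: inner_diff_left inner_diff_right spd_inv_cancel[OF spd] inner_commute)
    finally show ?thesis
      unfolding g_def gauss_density_def
      by (simp add: y_def[symmetric] exp_add[symmetric] exp_diff[symmetric] field_simps)
  qed
  show ?thesis
    unfolding gauss_def g_def[symmetric] using I
    by (subst has_bochner_integral_density) (auto simp: less_imp_le[OF pos] eq)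
qed

text \<open>Second-order Taylor bound for \<open>exp x + exp (- x)\<close>; it dominates the difference quotients from which the
second moment is read off below.\<close>

lemma abs_exp_second_difference_le:
  fixes x :: real
  shows "\<bar>exp x + exp (- x) - 2\<bar> \<le> x\<^sup>2 * exp \<bar>x\<bar>"
proof -
  have *: "\<exists>r\<ge>0. r \<le> exp \<bar>y\<bar> \<and> exp y = 1 + y + r / 2 * y\<^sup>2" for y :: real
  proof -
    obtain t where t: "\<bar>t\<bar> \<le> \<bar>y\<bar>" "exp y = (\<Sum>m<2. y ^ m / fact m) + exp t / fact 2 * y ^ 2"
      using Maclaurin_exp_le[of y 2] by auto
    then have "0 \<le> exp t" "exp t \<le> exp \<bar>y\<bar>" "exp y = 1 + y + exp t / 2 * y\<^sup>2"
      by (auto simp: numeral_2_eq_2)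
    then show ?thesis by blast
  qed
  obtain r where r: "0 \<le> r" "r \<le> exp \<bar>x\<bar>" "exp x = 1 + x + r / 2 * x\<^sup>2" using *[of x] by auto
  obtain q where q: "0 \<le> q" "q \<le> exp \<bar>x\<bar>" "exp (-x) = 1 - x + q / 2 * x\<^sup>2" using *[of "-x"] by auto
  have eq: "exp x + exp (- x) - 2 = x\<^sup>2 * ((r + q) / 2)"
    using r(3) q(3) by (simp add: algebra_simps add_divide_distrib)
  show ?thesis
    unfolding eq abs_mult using r q by (intro mult_mono) auto
qed

text \<open>The first two moments are the first two derivatives of the moment generating function at \<open>0\<close>. Since
\<open>1 + t * Y \<le> exp (t * Y)\<close>, the difference \<open>exp (t\<^sup>2 * s / 2) - t * E Y\<close> has a minimum at \<open>t = 0\<close>, and its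
derivative there gives the mean. The second moment is the limit of symmetric second difference quotients
with step \<open>1 / Suc n\<close>, by dominated convergence.\<close>

lemma moments_of_gaussian_mgf:
  fixes Y :: "'w \<Rightarrow> real"
  assumes P: "prob_space N"
    and mgf: "\<And>t. has_bochner_integral N (\<lambda>x. exp (t * Y x)) (exp (t\<^sup>2 * s / 2))"
    and Y[measurable]: "Y \<in> borel_measurable N"
  shows "has_bochner_integral N Y 0" "has_bochner_integral N (\<lambda>x. (Y x)\<^sup>2) s"
proof -
  interpret prob_space N by fact
  have ei: "integrable N (\<lambda>x. exp (t * Y x))" and ee: "(\<integral>x. exp (t * Y x) \<partial>N) = exp (t\<^sup>2 * s / 2)" for t
    using mgf[of t] by (auto simp: has_bochner_integral_iff)
  define D where "D = (\<lambda>x. exp (Y x) + exp (- Y x))"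
  have abs_le: "\<bar>Y x\<bar> \<le> D x" for x
    using exp_ge_add_one_self[of "Y x"] exp_ge_add_one_self[of "- Y x"] exp_gt_zero[of "Y x"] exp_gt_zero[of "- Y x"]
    unfolding D_def by linarith
  have exp_le: "exp \<bar>Y x\<bar> \<le> D x" for x by (cases "Y x \<ge> 0") (auto simp: D_def)
  have sq_le: "(Y x)\<^sup>2 \<le> 2 * D x" for x
  proof -
    have "\<bar>Y x\<bar>\<^sup>2 / 2 \<le> exp \<bar>Y x\<bar>"
      using exp_lower_Taylor_quadratic[of "\<bar>Y x\<bar>"] by (simp del: power2_abs)
    with exp_le[of x] show ?thesis by simp
  qed
  have Di: "integrable N D" using ei[of 1] ei[of "-1"] by (simp add: D_def)
  have Yi: "integrable N Y"
    by (rule Bochner_Integration.integrable_bound[OF Di]) (auto intro!: AE_I2 order_trans[OF abs_le])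
  have Y2i: "integrable N (\<lambda>x. (Y x)\<^sup>2)"
    by (rule Bochner_Integration.integrable_bound[of _ "\<lambda>x. 2 * D x"])
      (use Di in \<open>auto intro!: AE_I2 order_trans[OF sq_le]\<close>)
  have "t * expectation Y \<le> exp (t\<^sup>2 * s / 2) - 1" for t
  proof -
    have "(\<integral>x. 1 + t * Y x \<partial>N) \<le> (\<integral>x. exp (t * Y x) \<partial>N)"
      using ei Yi by (intro integral_mono) auto
    then show ?thesis using Yi by (simp add: ee prob_space)
  qed
  then have min: "\<forall>t. \<bar>0 - t\<bar> < 1 \<longrightarrow> (\<lambda>t. exp (t\<^sup>2 * s / 2) - t * expectation Y) 0 \<le> (\<lambda>t. exp (t\<^sup>2 * s / 2) - t * expectation Y) t"
    by (auto simp: algebra_simps)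
  have "((\<lambda>t. exp (t\<^sup>2 * s / 2) - t * expectation Y) has_real_derivative - expectation Y) (at 0)"
    by (auto intro!: derivative_eq_intros)
  from DERIV_local_min[OF this zero_less_one min] have "expectation Y = 0" by simp
  with Yi show "has_bochner_integral N Y 0" by (simp add: has_bochner_integral_iff)
  define X where "X = (\<lambda>n x. (exp (Y x / Suc n) + exp (- (Y x / Suc n)) - 2) * (real (Suc n))\<^sup>2)"
  have XE: "expectation (X n) = 2 * (exp (s / (2 * (real (Suc n))\<^sup>2)) - 1) * (real (Suc n))\<^sup>2" for n
    using ei[of "1 / Suc n"] ei[of "- 1 / Suc n"] ee[of "1 / Suc n"] ee[of "- 1 / Suc n"]
    unfolding X_def by (simp add: power_divide prob_space field_simps)
  have lim: "(\<lambda>n. X n x) \<longlonglongrightarrow> (Y x)\<^sup>2" for x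
  proof -
    have *: "(\<lambda>n. (exp (y / Suc n) + exp (- (y / Suc n)) - 2) * (real (Suc n))\<^sup>2) \<longlonglongrightarrow> y * y"
      if "y > 0" for y :: real using that by real_asymp
    consider "Y x = 0" | "Y x > 0" | "- Y x > 0" by linarith
    then show ?thesis
      unfolding X_def by cases (use *[of "Y x"] *[of "- Y x"] in \<open>simp_all add: power2_eq_square add.commute\<close>)
  qed
  have bound: "\<bar>X n x\<bar> \<le> 2 * (D x)\<^sup>2" for n x
  proof -
    have "\<bar>X n x\<bar> \<le> (Y x / Suc n)\<^sup>2 * exp \<bar>Y x / Suc n\<bar> * (real (Suc n))\<^sup>2"
      unfolding X_def abs_mult using abs_exp_second_difference_le[of "Y x / Suc n"]
      by (intro mult_mono) auto
    also have "\<dots> = (Y x)\<^sup>2 * exp \<bar>Y x / Suc n\<bar>" by (simp add: power_divide)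
    also have "\<bar>Y x / Suc n\<bar> \<le> \<bar>Y x\<bar>" by (simp add: field_simps mult_left_le)
    then have "(Y x)\<^sup>2 * exp \<bar>Y x / Suc n\<bar> \<le> (2 * D x) * D x"
      using sq_le exp_le[of x] by (intro mult_mono) (auto simp: D_def intro: order_trans[OF _ exp_le[of x, unfolded D_def]])
    finally show ?thesis by (simp add: power2_eq_square)
  qed
  have D2: "integrable N (\<lambda>x. 2 * (D x)\<^sup>2)"
  proof -
    have "(D x)\<^sup>2 = exp (2 * Y x) + exp (- 2 * Y x) + 2" for x
      by (simp add: D_def power2_eq_square algebra_simps exp_add[symmetric])
    then show ?thesis using ei[of 2] ei[of "-2"] by simp
  qed
  have "(\<lambda>n. expectation (X n)) \<longlonglongrightarrow> expectation (\<lambda>x. (Y x)\<^sup>2)"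
    by (rule integral_dominated_convergence[OF _ _ D2]) (use lim bound in \<open>auto simp: X_def\<close>)
  moreover have "(\<lambda>n. expectation (X n)) \<longlonglongrightarrow> s"
  proof -
    consider "s = 0" | "s > 0" | "s < 0" by linarith
    then show ?thesis unfolding XE by cases (simp, real_asymp+)
  qed
  ultimately have "expectation (\<lambda>x. (Y x)\<^sup>2) = s" by (rule LIMSEQ_unique)
  with Y2i show "has_bochner_integral N (\<lambda>x. (Y x)\<^sup>2) s" by (simp add: has_bochner_integral_iff)
qed

lemma gauss_moments:
  fixes \<mu> k :: "real^'n"
  assumes "spd \<Gamma>" "prob_space (gauss \<mu> \<Gamma>)"
  shows "has_bochner_integral (gauss \<mu> \<Gamma>) (\<lambda>x. k \<bullet> (x - \<mu>)) 0"
    and "has_bochner_integral (gauss \<mu> \<Gamma>) (\<lambda>x. (k \<bullet> (x - \<mu>))\<^sup>2) (k \<bullet> (\<Gamma> *v k))"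
proof -
  have *: "has_bochner_integral (gauss \<mu> \<Gamma>) (\<lambda>x. exp (t * (k \<bullet> (x - \<mu>)))) (exp (t\<^sup>2 * (k \<bullet> (\<Gamma> *v k)) / 2))" for t
    using gauss_mgf[OF assms, of "t *\<^sub>R k"]
    by (simp add: power2_eq_square mult.assoc matrix_vector_mult_scaleR)
  have "(\<lambda>x. k \<bullet> (x - \<mu>)) \<in> borel_measurable (gauss \<mu> \<Gamma>)" by (simp add: gauss_def)
  from moments_of_gaussian_mgf[OF assms(2) * this]
  show "has_bochner_integral (gauss \<mu> \<Gamma>) (\<lambda>x. k \<bullet> (x - \<mu>)) 0"
    and "has_bochner_integral (gauss \<mu> \<Gamma>) (\<lambda>x. (k \<bullet> (x - \<mu>))\<^sup>2) (k \<bullet> (\<Gamma> *v k))" by auto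
qed

section \<open>Second moments and quadratic forms\<close>

text \<open>Polarisation: a quadratic form is a linear combination of squares of linear functionals. Hence its
expectation depends only on the function \<open>a \<mapsto> E (a \<bullet> V)\<^sup>2\<close>.\<close>

lemma quadratic_form_expand:
  fixes Q :: "real^'a^'a"
  shows "v \<bullet> (Q *v v) = (\<Sum>i\<in>UNIV. \<Sum>j\<in>UNIV. Q $ i $ j *
    ((((axis i 1 + axis j 1) \<bullet> v)\<^sup>2 - ((axis i 1 - axis j 1) \<bullet> v)\<^sup>2) / 4))"
proof -
  have "(((axis i 1 + axis j 1) \<bullet> v)\<^sup>2 - ((axis i 1 - axis j 1) \<bullet> v)\<^sup>2) / 4 = v $ i * v $ j" for i j
    by (simp add: inner_add_left inner_diff_left inner_axis' power2_eq_square algebra_simps)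
  then show ?thesis
    by (simp add: inner_vec_def matrix_vector_mult_def sum_distrib_left ac_simps)
qed

text \<open>The expectation of \<open>V \<bullet> (Q *v V)\<close> for a random vector \<open>V\<close> whose functionals \<open>a \<bullet> V\<close> have
second moment \<open>s a\<close>.\<close>

definition quadratic_form_mean :: "real^'a^'a \<Rightarrow> (real^'a \<Rightarrow> real) \<Rightarrow> real" where
  "quadratic_form_mean Q s =
    (\<Sum>i\<in>UNIV. \<Sum>j\<in>UNIV. Q $ i $ j * ((s (axis i 1 + axis j 1) - s (axis i 1 - axis j 1)) / 4))"

lemma has_bochner_integral_quadratic_form:
  fixes Q :: "real^'a^'a" and V :: "'w \<Rightarrow> real^'a"
  assumes "\<And>a. has_bochner_integral M (\<lambda>w. (a \<bullet> V w)\<^sup>2) (s a)"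
  shows "has_bochner_integral M (\<lambda>w. V w \<bullet> (Q *v V w)) (quadratic_form_mean Q s)"
  unfolding quadratic_form_expand quadratic_form_mean_def
  by (intro has_bochner_integral_sum has_bochner_integral_mult_right
      has_bochner_integral_divide has_bochner_integral_diff assms)

lemma has_bochner_integral_weak:
  fixes X :: "'w \<Rightarrow> 'a::euclidean_space"
  assumes "\<And>k. has_bochner_integral M (\<lambda>w. k \<bullet> X w) (k \<bullet> c)"
  shows "has_bochner_integral M X c"
proof -
  have "has_bochner_integral M (\<lambda>w. \<Sum>b\<in>Basis. (b \<bullet> X w) *\<^sub>R b) (\<Sum>b\<in>Basis. (b \<bullet> c) *\<^sub>R b)"
    by (intro has_bochner_integral_sum has_bochner_integral_scaleR_left assms)
  moreover have "(\<Sum>b\<in>Basis. (b \<bullet> v) *\<^sub>R b) = v" for v :: 'a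
    using euclidean_representation[of v] by (simp add: inner_commute)
  ultimately show ?thesis by simp
qed

lemma integrable_mult_of_squares:
  fixes u v :: "'w \<Rightarrow> real"
  assumes [measurable]: "u \<in> borel_measurable M" "v \<in> borel_measurable M"
    and "integrable M (\<lambda>w. (u w)\<^sup>2)" "integrable M (\<lambda>w. (v w)\<^sup>2)"
  shows "integrable M (\<lambda>w. u w * v w)"
proof (rule Bochner_Integration.integrable_bound)
  show "integrable M (\<lambda>w. (u w)\<^sup>2 + (v w)\<^sup>2)" using assms by simp
  have "\<bar>u w * v w\<bar> \<le> (u w)\<^sup>2 + (v w)\<^sup>2" for w
    using sum_squares_bound[of "\<bar>u w\<bar>" "\<bar>v w\<bar>"] mult_nonneg_nonneg[of "\<bar>u w\<bar>" "\<bar>v w\<bar>"]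
    unfolding abs_mult power2_abs by linarith
  then show "AE w in M. norm (u w * v w) \<le> norm ((u w)\<^sup>2 + (v w)\<^sup>2)" by simp
qed simp

text \<open>This turns the entrywise definition of the cross-covariance matrix into a bilinear form, which is
how all covariances enter below.\<close>

lemma cross_cov_form:
  fixes X :: "'w \<Rightarrow> real^'a" and Y :: "'w \<Rightarrow> real^'b"
  assumes [measurable]: "X \<in> borel_measurable M" "Y \<in> borel_measurable M"
    and X2: "\<And>a. integrable M (\<lambda>w. (a \<bullet> (X w - (\<integral>v. X v \<partial>M)))\<^sup>2)"
    and Y2: "\<And>b. integrable M (\<lambda>w. (b \<bullet> (Y w - (\<integral>v. Y v \<partial>M)))\<^sup>2)"
  shows "has_bochner_integral M
    (\<lambda>w. (a \<bullet> (X w - (\<integral>v. X v \<partial>M))) * (b \<bullet> (Y w - (\<integral>v. Y v \<partial>M)))) (a \<bullet> (cross_cov M X Y *v b))"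
proof -
  define x where "x w = X w - (\<integral>v. X v \<partial>M)" for w
  define y where "y w = Y w - (\<integral>v. Y v \<partial>M)" for w
  have [measurable]: "x \<in> borel_measurable M" "y \<in> borel_measurable M"
    by (auto simp: x_def[abs_def] y_def[abs_def])
  have "integrable M (\<lambda>w. (axis i 1 \<bullet> x w) * (axis j 1 \<bullet> y w))" for i j
    by (rule integrable_mult_of_squares) (use X2 Y2 in \<open>auto simp: x_def y_def\<close>)
  then have C: "has_bochner_integral M (\<lambda>w. x w $ i * y w $ j) (cross_cov M X Y $ i $ j)" for i j
    unfolding cross_cov_def x_def[symmetric] y_def[symmetric]
    by (simp add: has_bochner_integral_iff inner_axis')
  have "has_bochner_integral M (\<lambda>w. \<Sum>i\<in>UNIV. \<Sum>j\<in>UNIV. (a $ i * b $ j) * (x w $ i * y w $ j))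
    (\<Sum>i\<in>UNIV. \<Sum>j\<in>UNIV. (a $ i * b $ j) * cross_cov M X Y $ i $ j)"
    by (intro has_bochner_integral_sum has_bochner_integral_mult_right C)
  then show ?thesis
    unfolding x_def[symmetric] y_def[symmetric]
    by (simp add: inner_vec_def matrix_vector_mult_def sum_distrib_left sum_distrib_right ac_simps
        sum.swap[of _ "UNIV::'b set" "UNIV::'a set"])
qed

section \<open>Independence\<close>

text \<open>The preimage families of \<open>f \<circ> X\<close> and \<open>g \<circ> Y\<close> are contained in those of \<open>X\<close> and \<open>Y\<close>. Real-valued functions of
independent variables of different types are thus independent in the sense of \<open>indep_var\<close>, and the
product rule for expectations becomes available.\<close>

lemma indep_rv_indep_var:
  fixes X :: "'w \<Rightarrow> 'a::topological_space" and Y :: "'w \<Rightarrow> 'b::topological_space"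
    and f :: "'a \<Rightarrow> real" and g :: "'b \<Rightarrow> real"
  assumes "prob_space M" "indep_rv M X Y" "X \<in> borel_measurable M" "Y \<in> borel_measurable M"
    and f: "f \<in> borel_measurable borel" and g: "g \<in> borel_measurable borel"
  shows "prob_space.indep_var M borel (\<lambda>w. f (X w)) borel (\<lambda>w. g (Y w))"
proof -
  interpret prob_space M by fact
  have X: "{(\<lambda>w. f (X w)) -` A \<inter> space M |A. A \<in> sets borel} \<subseteq> {X -` A \<inter> space M |A. A \<in> sets borel}"
  proof safe
    fix A :: "real set" assume "A \<in> sets borel"
    then show "\<exists>B. (\<lambda>w. f (X w)) -` A \<inter> space M = X -` B \<inter> space M \<and> B \<in> sets borel"
      using measurable_sets[OF f] by (intro exI[of _ "f -` A"]) auto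
  qed
  have Y: "{(\<lambda>w. g (Y w)) -` A \<inter> space M |A. A \<in> sets borel} \<subseteq> {Y -` A \<inter> space M |A. A \<in> sets borel}"
  proof safe
    fix A :: "real set" assume "A \<in> sets borel"
    then show "\<exists>B. (\<lambda>w. g (Y w)) -` A \<inter> space M = Y -` B \<inter> space M \<and> B \<in> sets borel"
      using measurable_sets[OF g] by (intro exI[of _ "g -` A"]) auto
  qed
  have sig: "sigma_sets (space M) {h -` A \<inter> space M |A. A \<in> sets borel} = {h -` A \<inter> space M |A. A \<in> sets borel}"
    for h :: "'w \<Rightarrow> real"
    using sets_vimage_algebra[of "space M" h borel] sets_vimage_algebra2[of h "space M" borel] by simp
  have fX: "(\<lambda>w. f (X w)) \<in> borel_measurable M" and gY: "(\<lambda>w. g (Y w)) \<in> borel_measurable M"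
    using assms by (auto intro: measurable_compose)
  have "indep_set {(\<lambda>w. f (X w)) -` A \<inter> space M |A. A \<in> sets borel}
      {(\<lambda>w. g (Y w)) -` A \<inter> space M |A. A \<in> sets borel}"
    unfolding indep_set_def
  proof (rule indep_sets_mono_sets)
    show "indep_sets (case_bool {X -` A \<inter> space M |A. A \<in> sets borel}
        {Y -` B \<inter> space M |B. B \<in> sets borel}) UNIV"
      using assms(2) by (simp add: indep_rv_def indep_set_def)
  next
    fix i :: bool
    show "case_bool {(\<lambda>w. f (X w)) -` A \<inter> space M |A. A \<in> sets borel}
        {(\<lambda>w. g (Y w)) -` A \<inter> space M |A. A \<in> sets borel} i
      \<subseteq> case_bool {X -` A \<inter> space M |A. A \<in> sets borel} {Y -` B \<inter> space M |B. B \<in> sets borel} i"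
      using X Y by (cases i) (simp_all only: bool.case)
  qed
  then show ?thesis
    using fX gY by (simp add: indep_var_eq sig)
qed

lemma indep_rv_sum_square:
  fixes X :: "'w \<Rightarrow> 'a::topological_space" and Y :: "'w \<Rightarrow> 'b::topological_space"
    and f :: "'a \<Rightarrow> real" and g :: "'b \<Rightarrow> real"
  assumes "prob_space M" "indep_rv M X Y" "X \<in> borel_measurable M" "Y \<in> borel_measurable M"
    and "f \<in> borel_measurable borel" "g \<in> borel_measurable borel"
    and f: "has_bochner_integral M (\<lambda>w. f (X w)) 0" and g: "has_bochner_integral M (\<lambda>w. g (Y w)) 0"
    and f2: "has_bochner_integral M (\<lambda>w. (f (X w))\<^sup>2) a" and g2: "has_bochner_integral M (\<lambda>w. (g (Y w))\<^sup>2) b"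
  shows "has_bochner_integral M (\<lambda>w. (f (X w) + g (Y w))\<^sup>2) (a + b)"
proof -
  interpret prob_space M by fact
  have iv: "indep_var borel (\<lambda>w. f (X w)) borel (\<lambda>w. g (Y w))"
    by (rule indep_rv_indep_var) fact+
  have "has_bochner_integral M (\<lambda>w. f (X w) * g (Y w)) 0"
    using indep_var_integrable[OF iv] indep_var_lebesgue_integral[OF iv] f g
    by (simp add: has_bochner_integral_iff)
  from has_bochner_integral_add[OF has_bochner_integral_add[OF f2 g2] has_bochner_integral_mult_right[OF this, of 2]]
  show ?thesis by (simp add: power2_sum mult.assoc)
qed

text \<open>Rectangles generate the product sigma-algebra, and on rectangles the claim is independence itself.\<close>

lemma indep_rv_joint_distr:
  fixes X :: "'w \<Rightarrow> 'a::topological_space" and Y :: "'w \<Rightarrow> 'b::topological_space"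
  assumes P: "prob_space M" and ind: "indep_rv M X Y"
    and [measurable]: "X \<in> borel_measurable M" "Y \<in> borel_measurable M"
  shows "distr M borel X \<Otimes>\<^sub>M distr M borel Y = distr M (borel \<Otimes>\<^sub>M borel) (\<lambda>w. (X w, Y w))"
proof -
  interpret prob_space M by fact
  interpret X: prob_space "distr M borel X" by (rule prob_space_distr) simp
  interpret Y: prob_space "distr M borel Y" by (rule prob_space_distr) simp
  show ?thesis
  proof (rule pair_measure_eqI)
    fix A :: "'a set" and B :: "'b set"
    assume "A \<in> sets (distr M borel X)" "B \<in> sets (distr M borel Y)"
    then have [measurable]: "A \<in> sets borel" "B \<in> sets borel" by auto
    have "prob ((X -` A \<inter> space M) \<inter> (Y -` B \<inter> space M)) = prob (X -` A \<inter> space M) * prob (Y -` B \<inter> space M)"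
      using ind unfolding indep_rv_def by (rule indep_setD) auto
    moreover have "(X -` A \<inter> space M) \<inter> (Y -` B \<inter> space M) = (\<lambda>w. (X w, Y w)) -` (A \<times> B) \<inter> space M" by auto
    ultimately show "emeasure (distr M borel X) A * emeasure (distr M borel Y) B
        = emeasure (distr M (borel \<Otimes>\<^sub>M borel) (\<lambda>w. (X w, Y w))) (A \<times> B)"
      by (simp add: emeasure_distr emeasure_eq_measure ennreal_mult[symmetric])
  qed (simp_all add: X.sigma_finite_measure_axioms Y.sigma_finite_measure_axioms cong: sets_pair_measure_cong)
qed

text \<open>Joint density of data and parameter in an additive noise model: for a fixed parameter value \<open>x\<close> the data
are the noise shifted by \<open>G x\<close>, so translation invariance moves the shift into the noise density.\<close>

lemma distributed_shifted_noise:
  fixes X :: "'w \<Rightarrow> 'a::euclidean_space" and Y :: "'w \<Rightarrow> 'b::euclidean_space"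
  assumes P: "prob_space M" and ind: "indep_rv M X Y"
    and X: "distributed M lborel X f" and Y: "distributed M lborel Y g"
    and G[measurable]: "G \<in> borel_measurable borel"
  shows "distributed M lborel (\<lambda>w. (G (X w) + Y w, X w)) (\<lambda>z. f (snd z) * g (fst z - G (snd z)))"
proof -
  have [measurable]: "X \<in> borel_measurable M" "Y \<in> borel_measurable M" "f \<in> borel_measurable borel" "g \<in> borel_measurable borel"
    using X Y by (auto simp: distributed_def)
  interpret prob_space M by fact
  have dX: "distr M borel X = density lborel f" and dY: "distr M borel Y = density lborel g"
    using X Y by (auto simp: distributed_def cong: distr_cong)
  interpret X: prob_space "density lborel f" unfolding dX[symmetric] by (rule prob_space_distr) simp
  interpret Y: prob_space "density lborel g" unfolding dY[symmetric] by (rule prob_space_distr) simp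
  have "density lborel f \<Otimes>\<^sub>M density lborel g = density (lborel \<Otimes>\<^sub>M lborel) (\<lambda>(x, y). f x * g y)"
    by (rule pair_measure_density) (auto intro: Y.sigma_finite_measure_axioms lborel.sigma_finite_measure_axioms)
  then have J: "distr M (borel \<Otimes>\<^sub>M borel) (\<lambda>w. (X w, Y w)) = density (lborel \<Otimes>\<^sub>M lborel) (\<lambda>(x, y). f x * g y)"
    using indep_rv_joint_distr[OF P ind] by (simp add: dX dY)
  have "(\<lambda>z. f (snd z) * g (fst z - G (snd z))) \<in> borel_measurable (borel \<Otimes>\<^sub>M borel)"
    by measurable
  then have dens: "(\<lambda>z. f (snd z) * g (fst z - G (snd z))) \<in> borel_measurable borel"
    by (subst (asm) borel_prod)
  have meas: "(\<lambda>w. (G (X w) + Y w, X w)) \<in> borel_measurable M" by measurable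
  have "distr M lborel (\<lambda>w. (G (X w) + Y w, X w)) = density lborel (\<lambda>z. f (snd z) * g (fst z - G (snd z)))"
  proof (rule measure_eqI)
    fix A assume "A \<in> sets (distr M lborel (\<lambda>w. (G (X w) + Y w, X w)))"
    then have A: "A \<in> sets (borel \<Otimes>\<^sub>M borel)" by (subst borel_prod) simp
    then have [measurable]: "A \<in> sets borel" by (subst (asm) borel_prod)
    note A[measurable]
    have "emeasure (distr M lborel (\<lambda>w. (G (X w) + Y w, X w))) A = (\<integral>\<^sup>+w. indicator A (G (X w) + Y w, X w) \<partial>M)"
      using nn_integral_distr[of "\<lambda>w. (G (X w) + Y w, X w)" M lborel "indicator A"] meas by simp
    also have "\<dots> = (\<integral>\<^sup>+z. indicator A (G (fst z) + snd z, fst z) \<partial>distr M (borel \<Otimes>\<^sub>M borel) (\<lambda>w. (X w, Y w)))"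
      by (subst nn_integral_distr) simp_all
    also have "\<dots> = (\<integral>\<^sup>+z. f (fst z) * g (snd z) * indicator A (G (fst z) + snd z, fst z) \<partial>(lborel \<Otimes>\<^sub>M lborel))"
      unfolding J by (subst nn_integral_density) (simp_all add: case_prod_beta)
    also have "\<dots> = (\<integral>\<^sup>+x. \<integral>\<^sup>+y. f x * g y * indicator A (G x + y, x) \<partial>lborel \<partial>lborel)"
      by (subst lborel.nn_integral_fst[symmetric]) simp_all
    also have "\<dots> = (\<integral>\<^sup>+x. \<integral>\<^sup>+d. f x * g (d - G x) * indicator A (d, x) \<partial>lborel \<partial>lborel)"
    proof (rule nn_integral_cong)
      fix x
      have "(\<integral>\<^sup>+y. f x * g y * indicator A (G x + y, x) \<partial>lborel)
          = (\<integral>\<^sup>+y. f x * g y * indicator A (G x + y, x) \<partial>distr lborel borel ((+) (- G x)))"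
        by (simp add: lborel_distr_plus)
      also have "\<dots> = (\<integral>\<^sup>+d. f x * g (d - G x) * indicator A (d, x) \<partial>lborel)"
        by (subst nn_integral_distr) simp_all
      finally show "(\<integral>\<^sup>+y. f x * g y * indicator A (G x + y, x) \<partial>lborel) = \<dots>" .
    qed
    also have "\<dots> = (\<integral>\<^sup>+z. f (snd z) * g (fst z - G (snd z)) * indicator A z \<partial>(lborel \<Otimes>\<^sub>M lborel))"
      by (subst lborel_pair.nn_integral_snd[symmetric]) simp_all
    also have "\<dots> = emeasure (density lborel (\<lambda>z. f (snd z) * g (fst z - G (snd z)))) A"
      by (subst emeasure_density) (simp_all add: lborel_prod dens)
    finally show "emeasure (distr M lborel (\<lambda>w. (G (X w) + Y w, X w))) A = \<dots>" .
  qed simp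
  then show ?thesis
    using dens meas by (simp add: distributed_def)
qed

section \<open>Second moments of the two models\<close>

lemma prob_space_gauss_of_distributed:
  assumes "prob_space M" "distributed M lborel X (gauss_density \<mu> \<Gamma>)"
  shows "prob_space (gauss \<mu> \<Gamma>)"
  using prob_space.prob_space_distr[OF assms(1), of X lborel] assms(2)
  by (simp add: distributed_def gauss_def)

lemma has_bochner_integral_gauss_distributed:
  fixes f :: "real^'a \<Rightarrow> real"
  assumes X: "distributed M lborel X (gauss_density \<mu> \<Gamma>)"
    and f: "has_bochner_integral (gauss \<mu> \<Gamma>) f I"
  shows "has_bochner_integral M (\<lambda>w. f (X w)) I"
proof -
  have [measurable]: "f \<in> borel_measurable borel"
    using borel_measurable_has_bochner_integral[OF f] by (simp add: gauss_def)
  have "X \<in> measurable M lborel" and d: "distr M lborel X = gauss \<mu> \<Gamma>"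
    using X by (simp_all add: distributed_def gauss_def)
  then show ?thesis
    using f integrable_distr_eq[of X M lborel f] integral_distr[of X M lborel f]
    by (simp add: has_bochner_integral_iff d)
qed

lemma gauss_mean:
  fixes \<mu> :: "real^'n"
  assumes "spd \<Gamma>" and P: "prob_space (gauss \<mu> \<Gamma>)"
  shows "has_bochner_integral (gauss \<mu> \<Gamma>) (\<lambda>x. x) \<mu>"
proof -
  interpret prob_space "gauss \<mu> \<Gamma>" by fact
  have "has_bochner_integral (gauss \<mu> \<Gamma>) (\<lambda>x. x - \<mu>) 0"
    by (rule has_bochner_integral_weak) (use gauss_moments(1)[OF assms] in simp)
  moreover have "has_bochner_integral (gauss \<mu> \<Gamma>) (\<lambda>x. \<mu>) \<mu>"
    by (simp add: has_bochner_integral_iff prob_space)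
  ultimately have "has_bochner_integral (gauss \<mu> \<Gamma>) (\<lambda>x. (x - \<mu>) + \<mu>) (0 + \<mu>)"
    by (rule has_bochner_integral_add)
  then show ?thesis by simp
qed

lemma square_integrable_centred:
  fixes F :: "'w \<Rightarrow> 'a::euclidean_space"
  assumes P: "prob_space N" and [measurable]: "F \<in> borel_measurable N"
    and L2: "integrable N (\<lambda>x. (norm (F x))\<^sup>2)"
  shows "integrable N F" and "integrable N (\<lambda>x. (a \<bullet> (F x - c))\<^sup>2)"
proof -
  interpret prob_space N by fact
  show "integrable N F"
  proof (rule Bochner_Integration.integrable_bound)
    show "integrable N (\<lambda>x. 1 + (norm (F x))\<^sup>2)" using L2 by simp
    have "norm (F x) \<le> 1 + (norm (F x))\<^sup>2" for x
      using sum_squares_bound[of 1 "norm (F x)"] norm_ge_zero[of "F x"] by (simp only: power_one mult_1_right)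
    then show "AE x in N. norm (F x) \<le> norm (1 + (norm (F x))\<^sup>2)" by simp
  qed simp
  show "integrable N (\<lambda>x. (a \<bullet> (F x - c))\<^sup>2)"
  proof (rule Bochner_Integration.integrable_bound)
    show "integrable N (\<lambda>x. (norm a)\<^sup>2 * (2 * (norm (F x))\<^sup>2 + 2 * (norm c)\<^sup>2))" using L2 by simp
    have "(a \<bullet> (F x - c))\<^sup>2 \<le> (norm a)\<^sup>2 * (2 * (norm (F x))\<^sup>2 + 2 * (norm c)\<^sup>2)" for x
    proof -
      have "\<bar>a \<bullet> (F x - c)\<bar> \<le> norm a * norm (F x - c)" by (rule Cauchy_Schwarz_ineq2)
      also have "\<dots> \<le> norm a * (norm (F x) + norm c)" by (intro mult_left_mono norm_triangle_ineq4) simp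
      finally have "\<bar>a \<bullet> (F x - c)\<bar>\<^sup>2 \<le> (norm a * (norm (F x) + norm c))\<^sup>2" by (rule power_mono) simp
      also have "\<dots> \<le> (norm a)\<^sup>2 * (2 * (norm (F x))\<^sup>2 + 2 * (norm c)\<^sup>2)"
        unfolding power_mult_distrib using sum_squares_bound[of "norm (F x)" "norm c"]
        by (intro mult_left_mono) (auto simp: power2_sum)
      finally show ?thesis by simp
    qed
    then show "AE x in N. norm ((a \<bullet> (F x - c))\<^sup>2) \<le> norm ((norm a)\<^sup>2 * (2 * (norm (F x))\<^sup>2 + 2 * (norm c)\<^sup>2))"
      by (auto intro: order_trans)
  qed simp
qed

lemma forward_map_second_moments:
  fixes F :: "real^'n \<Rightarrow> real^'k" and mb :: "real^'n" and Gm :: "real^'n^'n"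
  defines "N \<equiv> gauss mb Gm"
  assumes spd: "spd Gm" and P: "prob_space N"
    and F: "F \<in> borel_measurable borel" and L2: "integrable N (\<lambda>x. (norm (F x))\<^sup>2)"
  shows "has_bochner_integral N (\<lambda>x. k \<bullet> (F x - (\<integral>x. F x \<partial>N)) + a \<bullet> (x - mb)) 0"
    and "has_bochner_integral N (\<lambda>x. (k \<bullet> (F x - (\<integral>x. F x \<partial>N)) + a \<bullet> (x - mb))\<^sup>2)
      (k \<bullet> (cross_cov N F F *v k) + 2 * (k \<bullet> (cross_cov N F (\<lambda>x. x) *v a)) + a \<bullet> (Gm *v a))"
proof -
  interpret prob_space N by fact
  have [measurable]: "F \<in> borel_measurable N" "(\<lambda>x. x) \<in> borel_measurable N"
    using F by (auto simp: N_def gauss_def)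
  have m: "(\<integral>x. x \<partial>N) = mb"
    using gauss_mean[OF spd] P by (simp add: N_def has_bochner_integral_iff)
  note F12 = square_integrable_centred[OF P _ L2]
  have "has_bochner_integral N (\<lambda>x. k \<bullet> (F x - (\<integral>x. F x \<partial>N))) 0"
    using F12(1) by (simp add: has_bochner_integral_iff prob_space inner_diff_right)
  from has_bochner_integral_add[OF this] gauss_moments(1)[OF spd, of mb a] P
  show "has_bochner_integral N (\<lambda>x. k \<bullet> (F x - (\<integral>x. F x \<partial>N)) + a \<bullet> (x - mb)) 0"
    by (force simp: N_def)
  have lin2: "integrable N (\<lambda>x. (b \<bullet> (x - (\<integral>x. x \<partial>N)))\<^sup>2)" for b
    using gauss_moments(2)[OF spd, of mb b] P unfolding m by (simp add: N_def has_bochner_integral_iff)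
  have 1: "has_bochner_integral N (\<lambda>x. (k \<bullet> (F x - (\<integral>x. F x \<partial>N))) * (k \<bullet> (F x - (\<integral>x. F x \<partial>N)))) (k \<bullet> (cross_cov N F F *v k))"
    by (rule cross_cov_form) (use F12(2) in auto)
  have 2: "has_bochner_integral N (\<lambda>x. (k \<bullet> (F x - (\<integral>x. F x \<partial>N))) * (a \<bullet> (x - mb))) (k \<bullet> (cross_cov N F (\<lambda>x. x) *v a))"
    using cross_cov_form[of F N "\<lambda>x. x" k a] F12(2) lin2 by (simp add: m)
  have 3: "has_bochner_integral N (\<lambda>x. (a \<bullet> (x - mb))\<^sup>2) (a \<bullet> (Gm *v a))"
    using gauss_moments(2)[OF spd, of mb a] P by (simp add: N_def)
  from has_bochner_integral_add[OF has_bochner_integral_add[OF 1 has_bochner_integral_mult_right[OF 2, of 2]] 3]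
  show "has_bochner_integral N (\<lambda>x. (k \<bullet> (F x - (\<integral>x. F x \<partial>N)) + a \<bullet> (x - mb))\<^sup>2)
      (k \<bullet> (cross_cov N F F *v k) + 2 * (k \<bullet> (cross_cov N F (\<lambda>x. x) *v a)) + a \<bullet> (Gm *v a))"
    by (simp add: power2_sum power2_eq_square algebra_simps)
qed

text \<open>The algebra behind the choice of the pure-BAE operator and covariance. In a combination
\<open>k \<bullet> (F x - B *v x) + l \<bullet> x\<close> with \<open>B = cross_cov N F (\<lambda>x. x) ** matrix_inv Gm\<close> the residual
\<open>F x - B *v x\<close> is uncorrelated with \<open>x\<close>, so the mixed terms in \<open>k\<close> and \<open>l\<close> cancel; what remains in \<open>k\<close> is the Schur complement in the
definition of \<open>bae_cov\<close>. Here \<open>a\<close> is the total coefficient of \<open>x\<close>.\<close>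

lemma bae_cov_form:
  fixes F :: "real^'n \<Rightarrow> real^'k" and mb :: "real^'n" and Gm :: "real^'n^'n" and k :: "real^'k" and l :: "real^'n"
  assumes spd: "spd Gm"
  defines "N \<equiv> gauss mb Gm"
  defines "a \<equiv> l - transpose (bae_op F mb Gm) *v k"
  shows "k \<bullet> (cross_cov N F F *v k) + 2 * (k \<bullet> (cross_cov N F (\<lambda>x. x) *v a)) + a \<bullet> (Gm *v a) + k \<bullet> (Ge *v k)
    = k \<bullet> (bae_cov F mb Gm Ge *v k) + l \<bullet> (Gm *v l)"
proof -
  let ?A = "matrix_inv Gm"
  define C where "C = cross_cov N F (\<lambda>x. x)"
  define u where "u = transpose C *v k"
  have tA: "transpose ?A = ?A" using spd_inv[OF spd] by (simp add: spd_def)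
  have B: "transpose (bae_op F mb Gm) *v k = ?A *v u"
    unfolding bae_op_def N_def[symmetric] C_def[symmetric]
    by (simp only: matrix_transpose_mul matrix_vector_mul_assoc[symmetric] tA u_def)
  have kC: "k \<bullet> (C *v x) = u \<bullet> x" for x by (simp only: inner_matrix_adjoint u_def)
  have S: "k \<bullet> (bae_cov F mb Gm Ge *v k) = k \<bullet> (Ge *v k) + k \<bullet> (cross_cov N F F *v k) - u \<bullet> (?A *v u)"
    unfolding bae_cov_def N_def[symmetric] C_def[symmetric]
    by (simp only: matrix_vector_mult_add_rdistrib matrix_vector_mult_diff_rdistrib matrix_vector_mul_assoc[symmetric]
        inner_add_right inner_diff_right kC u_def[symmetric])
  have G: "(?A *v u) \<bullet> (Gm *v l) = u \<bullet> l"
    using spd_sym[OF spd, of "?A *v u" l] by (simp add: spd_inv_cancel[OF spd] inner_commute[of l u])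
  have "a \<bullet> (Gm *v a) = l \<bullet> (Gm *v l) - 2 * (u \<bullet> l) + u \<bullet> (?A *v u)"
    unfolding a_def B matrix_vector_mult_diff_distrib spd_inv_cancel[OF spd]
    by (simp add: inner_diff_left inner_diff_right G inner_commute[of l u] inner_commute[of "?A *v u" u])
  moreover have "k \<bullet> (C *v a) = u \<bullet> l - u \<bullet> (?A *v u)"
    unfolding kC a_def B by (simp add: inner_diff_right)
  ultimately show ?thesis
    unfolding C_def[symmetric] S by simp
qed

text \<open>Without the summand \<open>Ge\<close>, the matrix is the covariance of the residual \<open>F x - B *v x\<close>, hence positive semidefinite.\<close>

lemma spd_bae_cov:
  fixes F :: "real^'n \<Rightarrow> real^'k"
  assumes spd: "spd Gm" and e: "spd Ge" and P: "prob_space (gauss mb Gm)"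
    and F: "F \<in> borel_measurable borel" and L2: "integrable (gauss mb Gm) (\<lambda>x. (norm (F x))\<^sup>2)"
  shows "spd (bae_cov F mb Gm Ge)"
proof -
  let ?N = "gauss mb Gm"
  have "transpose (matrix_inv Gm) = matrix_inv Gm" "transpose Ge = Ge"
    using spd_inv[OF spd] e by (simp_all add: spd_def)
  moreover have "transpose (cross_cov ?N F F) = cross_cov ?N F F"
    by (simp add: transpose_def cross_cov_def vec_eq_iff mult.commute)
  moreover have "transpose (X + Y) = transpose X + transpose Y" "transpose (X - Y) = transpose X - transpose Y" for X Y :: "real^'k^'k"
    by (simp_all add: transpose_def vec_eq_iff)
  ultimately have "transpose (bae_cov F mb Gm Ge) = bae_cov F mb Gm Ge"
    unfolding bae_cov_def by (simp add: matrix_transpose_mul matrix_mul_assoc)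
  moreover have "k \<bullet> (bae_cov F mb Gm Ge *v k) > 0" if "k \<noteq> 0" for k
  proof -
    define a where "a = 0 - transpose (bae_op F mb Gm) *v k"
    have "0 \<le> k \<bullet> (cross_cov ?N F F *v k) + 2 * (k \<bullet> (cross_cov ?N F (\<lambda>x. x) *v a)) + a \<bullet> (Gm *v a)"
      by (subst has_bochner_integral_integral_eq[OF forward_map_second_moments(2)[OF spd P F L2], symmetric]) simp
    moreover have "0 < k \<bullet> (Ge *v k)" using e that by (simp add: spd_def)
    ultimately show ?thesis
      using bae_cov_form[OF spd, where k=k and l=0 and F=F and mb=mb and Ge=Ge] by (simp add: a_def)
  qed
  ultimately show ?thesis by (simp add: spd_def)
qed

text \<open>With the next lemma: the residual \<open>d - B *v m\<close> and the parameter have the same joint second moments in the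
accurate and in the linear model, so that centred quadratic forms have the same expectation in both.\<close>

lemma accurate_model_second_moments:
  fixes F :: "real^'n \<Rightarrow> real^'k"
  assumes spd: "spd Gm" "spd Ge" and F[measurable]: "F \<in> borel_measurable borel"
    and L2: "integrable (gauss mb Gm) (\<lambda>x. (norm (F x))\<^sup>2)"
    and M: "prob_space M" and m: "distributed M lborel m (gauss_density mb Gm)"
    and e: "distributed M lborel e (gauss_density eb Ge)" and ind: "indep_rv M m e"
  shows "has_bochner_integral M
    (\<lambda>w. (k \<bullet> (F (m w) + e w - bae_op F mb Gm *v m w - bae_mean F mb Gm eb) + l \<bullet> (m w - mb))\<^sup>2)
    (k \<bullet> (bae_cov F mb Gm Ge *v k) + l \<bullet> (Gm *v l))"
proof -
  let ?B = "bae_op F mb Gm"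
  \<comment> \<open>The total coefficient of \<open>m w\<close>: the residual contributes \<open>- transpose ?B *v k\<close>.\<close>
  define a where "a = l - transpose ?B *v k"
  define f where "f x = k \<bullet> (F x - (\<integral>x. F x \<partial>gauss mb Gm)) + a \<bullet> (x - mb)" for x
  define g where "g y = k \<bullet> (y - eb)" for y
  have Pm: "prob_space (gauss mb Gm)" and Pe: "prob_space (gauss eb Ge)"
    using prob_space_gauss_of_distributed M m e by blast+
  have [measurable]: "m \<in> borel_measurable M" "e \<in> borel_measurable M"
    using m e by (auto simp: distributed_def)
  have "has_bochner_integral M (\<lambda>w. (f (m w) + g (e w))\<^sup>2)
    ((k \<bullet> (cross_cov (gauss mb Gm) F F *v k) + 2 * (k \<bullet> (cross_cov (gauss mb Gm) F (\<lambda>x. x) *v a)) + a \<bullet> (Gm *v a)) + k \<bullet> (Ge *v k))"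
    by (rule indep_rv_sum_square[OF M ind])
      (auto simp: f_def[abs_def] g_def[abs_def]
        intro!: has_bochner_integral_gauss_distributed[OF m] has_bochner_integral_gauss_distributed[OF e]
          gauss_moments[OF spd(2) Pe] forward_map_second_moments[OF spd(1) Pm F L2])
  moreover have "f (m w) + g (e w) = k \<bullet> (F (m w) + e w - ?B *v m w - bae_mean F mb Gm eb) + l \<bullet> (m w - mb)" for w
  proof -
    have "a \<bullet> (m w - mb) = l \<bullet> (m w - mb) - k \<bullet> (?B *v m w - ?B *v mb)"
      unfolding a_def inner_matrix_adjoint[of k, symmetric] inner_diff_left matrix_vector_mult_diff_distrib[symmetric]
      by (simp only: inner_matrix_adjoint)
    then show ?thesis
      unfolding f_def g_def bae_mean_def by (simp add: inner_diff_right inner_add_right)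
  qed
  ultimately show ?thesis
    using bae_cov_form[OF spd(1), where k=k and l=l and F=F and mb=mb and Ge=Ge] by (simp add: a_def)
qed

lemma linear_model_second_moments:
  fixes B :: "real^'n^'k"
  assumes spd: "spd Gm" "spd \<Gamma>"
    and M: "prob_space M" and m: "distributed M lborel m (gauss_density mb Gm)"
    and e: "distributed M lborel e (gauss_density eb \<Gamma>)" and ind: "indep_rv M m e"
  shows "has_bochner_integral M
    (\<lambda>w. (k \<bullet> (B *v m w + e w - B *v m w - eb) + l \<bullet> (m w - mb))\<^sup>2)
    (k \<bullet> (\<Gamma> *v k) + l \<bullet> (Gm *v l))"
proof -
  have Pm: "prob_space (gauss mb Gm)" and Pe: "prob_space (gauss eb \<Gamma>)"
    using prob_space_gauss_of_distributed M m e by blast+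
  have [measurable]: "m \<in> borel_measurable M" "e \<in> borel_measurable M"
    using m e by (auto simp: distributed_def)
  have "has_bochner_integral M (\<lambda>w. (l \<bullet> (m w - mb) + k \<bullet> (e w - eb))\<^sup>2) (l \<bullet> (Gm *v l) + k \<bullet> (\<Gamma> *v k))"
    by (rule indep_rv_sum_square[OF M ind])
      (auto intro!: has_bochner_integral_gauss_distributed[OF m] has_bochner_integral_gauss_distributed[OF e]
          gauss_moments[OF spd(1) Pm] gauss_moments[OF spd(2) Pe])
  then show ?thesis by (simp add: add.commute)
qed

section \<open>Joint densities and expected divergences\<close>

text \<open>If \<open>g\<close> is not absolutely continuous with respect to \<open>f\<close>, no Radon-Nikodym derivative exists,
\<open>RN_deriv\<close> is then \<open>0\<close> by convention, and with \<open>ln 0 = 0\<close> the divergence is \<open>0\<close>. Having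
the value in this case as well makes the divergence of the posteriors a measurable function of the data
everywhere, as Bochner integration over the data requires, rather than only up to a null set.\<close>

lemma KL_dens_eq_integral:
  fixes f g :: "'a::euclidean_space \<Rightarrow> real"
  assumes [measurable]: "f \<in> borel_measurable borel" "g \<in> borel_measurable borel"
    and f: "\<And>x. 0 \<le> f x" and g: "\<And>x. 0 \<le> g x"
  shows "KL_dens g f = (if AE x in lborel. f x = 0 \<longrightarrow> g x = 0 then \<integral>x. g x * ln (g x / f x) \<partial>lborel else 0)"
proof (cases "AE x in lborel. f x = 0 \<longrightarrow> g x = 0")
  case True
  then show ?thesis
    using lborel.KL_density_density[of "exp 1" f g] f g by (simp add: KL_dens_def log_def)
next
  case False
  have "\<not> (\<exists>h. h \<in> borel_measurable (density lborel f) \<and> density (density lborel f) h = density lborel g)"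
  proof safe
    fix h assume h: "h \<in> borel_measurable (density lborel f)" and eq: "density (density lborel f) h = density lborel g"
    have "AE x in density lborel f. f x \<noteq> 0" by (simp add: AE_density)
    then have "AE x in density (density lborel f) h. f x \<noteq> 0"
      using h by (simp add: AE_density)
    then have "AE x in lborel. 0 < g x \<longrightarrow> f x \<noteq> 0" unfolding eq by (simp add: AE_density)
    then have "AE x in lborel. f x = 0 \<longrightarrow> g x = 0"
      by eventually_elim (use g in \<open>force simp: less_le\<close>)
    with False show False by contradiction
  qed
  then have "RN_deriv (density lborel f) (density lborel g) = (\<lambda>_. 0)"
    unfolding RN_deriv_def by (rule if_not_P)
  with False show ?thesis
    by (simp add: KL_dens_def KL_divergence_def entropy_density_def comp_def log_def)
qed

text \<open>The pointwise form of Gibbs' inequality, from \<open>ln x \<le> x - 1\<close>. It bounds integrands of divergences from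
below by integrable functions, which gives both integrability and nonnegativity.\<close>

lemma gibbs_pointwise:
  fixes p s :: real
  assumes "0 \<le> p" "0 \<le> s" "s = 0 \<Longrightarrow> p = 0"
  shows "p - s \<le> p * ln (p / s)"
proof (cases "p = 0")
  case False
  then have pos: "0 < p" "0 < s" using assms by (auto simp: less_le)
  then have "ln (s / p) \<le> s / p - 1" by (intro ln_le_minus_one) simp
  then have "p * ln (s / p) \<le> p * (s / p - 1)" using pos by (intro mult_left_mono) auto
  then show ?thesis using pos by (simp add: ln_div algebra_simps)
qed (use assms in simp)

locale joint_density =
  fixes p :: "'d::euclidean_space \<times> 'p::euclidean_space \<Rightarrow> real"
  assumes borel[measurable]: "p \<in> borel_measurable (borel \<Otimes>\<^sub>M borel)"
    and nonneg: "0 \<le> p z"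
    and total: "has_bochner_integral (lborel \<Otimes>\<^sub>M lborel) p 1"
begin

lemma integrable_joint: "integrable (lborel \<Otimes>\<^sub>M lborel) p"
  and integral_joint: "(\<integral>z. p z \<partial>(lborel \<Otimes>\<^sub>M lborel)) = 1"
  using total by (simp_all add: has_bochner_integral_iff)

lemma borel_data_marginal[measurable]: "data_marginal p \<in> borel_measurable borel"
  unfolding data_marginal_def[abs_def] by measurable

lemma borel_param_marginal[measurable]: "param_marginal p \<in> borel_measurable borel"
  unfolding param_marginal_def[abs_def] by measurable

lemma borel_posterior[measurable]: "(\<lambda>z. posterior p (fst z) (snd z)) \<in> borel_measurable (borel \<Otimes>\<^sub>M borel)"
  unfolding posterior_def by measurable

lemma borel_posterior_snd[measurable]: "posterior p d \<in> borel_measurable borel"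
  unfolding posterior_def[abs_def] by measurable

lemma data_marginal_nonneg: "0 \<le> data_marginal p d"
  unfolding data_marginal_def by (simp add: nonneg)

lemma param_marginal_nonneg: "0 \<le> param_marginal p m"
  unfolding param_marginal_def by (simp add: nonneg)

lemma posterior_nonneg: "0 \<le> posterior p d m"
  unfolding posterior_def by (simp add: nonneg data_marginal_nonneg)

lemma has_bochner_integral_data_marginal: "has_bochner_integral lborel (data_marginal p) 1"
  using lborel_pair.integrable_fst'[OF integrable_joint] lborel_pair.integral_fst'[OF integrable_joint]
  by (simp add: data_marginal_def[abs_def] has_bochner_integral_iff integral_joint)

lemma has_bochner_integral_param_marginal: "has_bochner_integral lborel (param_marginal p) 1"
  using lborel_pair.integrable_snd[of "\<lambda>x y. p (x, y)"] lborel_pair.integral_snd[of "\<lambda>x y. p (x, y)"] integrable_joint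
  by (simp add: param_marginal_def[abs_def] has_bochner_integral_iff integral_joint)

text \<open>Where the data marginal vanishes, the joint density vanishes for almost all parameters. The null set
of data excluded here contains those for which \<open>p (d, m)\<close> is not integrable in \<open>m\<close>.\<close>

lemma AE_data_marginal_times_posterior:
  "AE d in lborel. AE m in lborel. p (d, m) = data_marginal p d * posterior p d m"
  using lborel_pair.AE_integrable_fst'[OF integrable_joint]
proof eventually_elim
  case (elim d)
  show ?case
  proof (cases "data_marginal p d = 0")
    case True
    then have "AE m in lborel. p (d, m) = 0"
      unfolding data_marginal_def using elim by (subst (asm) integral_nonneg_eq_0_iff_AE) (auto simp: nonneg)
    then show ?thesis using True by simp
  qed (simp add: posterior_def)
qed

lemma AE_joint_data_marginal_times_posterior:
  "AE z in lborel \<Otimes>\<^sub>M lborel. p z = data_marginal p (fst z) * posterior p (fst z) (snd z)"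
proof (rule lborel_pair.AE_pair_measure)
  show "{z \<in> space (lborel \<Otimes>\<^sub>M lborel). p z = data_marginal p (fst z) * posterior p (fst z) (snd z)}
      \<in> sets (lborel \<Otimes>\<^sub>M lborel)"
    by measurable
qed (use AE_data_marginal_times_posterior in simp)

lemma nn_integral_posterior_le_1: "(\<integral>\<^sup>+m. posterior p d m \<partial>lborel) \<le> 1"
proof (cases "data_marginal p d = 0")
  case False
  then have "integrable lborel (\<lambda>m. p (d, m))"
    unfolding data_marginal_def using not_integrable_integral_eq by blast
  then have "(\<integral>\<^sup>+m. posterior p d m \<partial>lborel) = ennreal (\<integral>m. posterior p d m \<partial>lborel)"
    unfolding posterior_def by (intro nn_integral_eq_integral) (auto simp: nonneg data_marginal_nonneg)
  also have "(\<integral>m. posterior p d m \<partial>lborel) = 1"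
    unfolding posterior_def using False by (simp add: data_marginal_def)
  finally show ?thesis by simp
qed (simp add: posterior_def)

text \<open>A density on the data multiplied by the posterior density is a joint subdensity: the posterior has
mass one where the data marginal is positive, and mass zero elsewhere because division by zero yields zero.\<close>

lemma reweighted_posterior:
  assumes s: "integrable lborel s" and s0: "\<And>d. 0 \<le> s d"
  shows "integrable (lborel \<Otimes>\<^sub>M lborel) (\<lambda>z. s (fst z) * posterior p (fst z) (snd z))"
    and "(\<integral>z. s (fst z) * posterior p (fst z) (snd z) \<partial>(lborel \<Otimes>\<^sub>M lborel)) \<le> (\<integral>d. s d \<partial>lborel)"
proof -
  have [measurable]: "s \<in> borel_measurable borel" using s by auto
  let ?I = "\<integral>\<^sup>+z. s (fst z) * posterior p (fst z) (snd z) \<partial>(lborel \<Otimes>\<^sub>M lborel)"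
  have "?I = (\<integral>\<^sup>+d. \<integral>\<^sup>+m. s d * posterior p d m \<partial>lborel \<partial>lborel)"
    by (subst lborel.nn_integral_fst[symmetric]) simp_all
  also have "\<dots> = (\<integral>\<^sup>+d. s d * (\<integral>\<^sup>+m. posterior p d m \<partial>lborel) \<partial>lborel)"
    by (simp add: ennreal_mult s0 posterior_nonneg nn_integral_cmult)
  also have "\<dots> \<le> (\<integral>\<^sup>+d. ennreal (s d) * 1 \<partial>lborel)"
    by (intro nn_integral_mono mult_left_mono nn_integral_posterior_le_1) simp
  also have "\<dots> = ennreal (\<integral>d. s d \<partial>lborel)"
    using s s0 by (simp add: nn_integral_eq_integral)
  finally have le: "?I \<le> ennreal (\<integral>d. s d \<partial>lborel)" .
  show int: "integrable (lborel \<Otimes>\<^sub>M lborel) (\<lambda>z. s (fst z) * posterior p (fst z) (snd z))"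
    by (rule integrableI_bounded)
      (use le in \<open>auto simp: s0 posterior_nonneg abs_mult intro: le_less_trans\<close>)
  show "(\<integral>z. s (fst z) * posterior p (fst z) (snd z) \<partial>(lborel \<Otimes>\<^sub>M lborel)) \<le> (\<integral>d. s d \<partial>lborel)"
    using le s0 nn_integral_eq_integral[OF int] by (simp add: posterior_nonneg)
qed

text \<open>The expected divergence of the posterior from a data-dependent reference density \<open>r\<close> is one integral
over the joint space. The exact and the approximate information gain and the expected divergence between the
posteriors are all of this form.\<close>

lemma expected_KL_dens:
  fixes r :: "'d \<times> 'p \<Rightarrow> real"
  assumes [measurable]: "r \<in> borel_measurable (borel \<Otimes>\<^sub>M borel)"
    and r0: "\<And>z. 0 \<le> r z" and rpos: "AE z in lborel \<Otimes>\<^sub>M lborel. 0 < r z"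
    and int: "integrable (lborel \<Otimes>\<^sub>M lborel) (\<lambda>z. p z * ln (posterior p (fst z) (snd z) / r z))"
  shows "(\<integral>d. KL_dens (posterior p d) (\<lambda>m. r (d, m)) \<partial>density lborel (data_marginal p))
    = (\<integral>z. p z * ln (posterior p (fst z) (snd z) / r z) \<partial>(lborel \<Otimes>\<^sub>M lborel))"
proof -
  define J where "J d = (\<integral>m. posterior p d m * ln (posterior p d m / r (d, m)) \<partial>lborel)" for d
  define K where "K d = KL_dens (posterior p d) (\<lambda>m. r (d, m))" for d
  have [measurable]: "J \<in> borel_measurable borel"
    unfolding J_def[abs_def] posterior_def by measurable
  have K: "K d = (if AE m in lborel. r (d, m) = 0 \<longrightarrow> posterior p d m = 0 then J d else 0)" for d
    unfolding K_def J_def by (rule KL_dens_eq_integral) (auto simp: r0 posterior_nonneg)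
  \<comment> \<open>Absolute continuity at \<open>d\<close> says that the section of \<open>B\<close> at \<open>d\<close> is a null set, a measurable condition on \<open>d\<close>.\<close>
  define B where "B = {z. r z = 0 \<and> posterior p (fst z) (snd z) \<noteq> 0}"
  have "B \<in> sets (borel \<Otimes>\<^sub>M borel)"
  proof -
    have "{z \<in> space (borel \<Otimes>\<^sub>M borel). r z = 0 \<and> posterior p (fst z) (snd z) \<noteq> 0} \<in> sets (borel \<Otimes>\<^sub>M borel)"
      by measurable
    then show ?thesis by (simp add: B_def space_pair_measure)
  qed
  note this[measurable]
  have AE_B: "(AE m in lborel. r (d, m) = 0 \<longrightarrow> posterior p d m = 0) \<longleftrightarrow> (\<integral>\<^sup>+m. indicator B (d, m) \<partial>lborel) = 0" for d
    by (subst nn_integral_0_iff_AE) (auto simp: B_def indicator_def)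
  have [measurable]: "K \<in> borel_measurable borel"
    unfolding K[abs_def] AE_B by measurable
  have "AE d in lborel. AE m in lborel. 0 < r (d, m)"
    using lborel_pair.AE_pair[OF rpos] by simp
  then have eq: "AE d in lborel. data_marginal p d * K d = (\<integral>m. p (d, m) * ln (posterior p d m / r (d, m)) \<partial>lborel)"
    using AE_data_marginal_times_posterior
  proof eventually_elim
    case (elim d)
    from elim(1) have "AE m in lborel. r (d, m) = 0 \<longrightarrow> posterior p d m = 0"
      by eventually_elim auto
    then have "data_marginal p d * K d = (\<integral>m. data_marginal p d * (posterior p d m * ln (posterior p d m / r (d, m))) \<partial>lborel)"
      by (simp add: K J_def)
    also have "\<dots> = (\<integral>m. p (d, m) * ln (posterior p d m / r (d, m)) \<partial>lborel)"
      using elim(2) by (intro integral_cong_AE) (auto elim: eventually_mono)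
    finally show ?case .
  qed
  have "(\<integral>d. K d \<partial>density lborel (data_marginal p)) = (\<integral>d. data_marginal p d * K d \<partial>lborel)"
    by (subst integral_density) (auto simp: data_marginal_nonneg)
  also have "\<dots> = (\<integral>d. \<integral>m. p (d, m) * ln (posterior p d m / r (d, m)) \<partial>lborel \<partial>lborel)"
    by (rule integral_cong_AE) (use eq in \<open>auto simp: posterior_def\<close>)
  also have "\<dots> = (\<integral>z. p z * ln (posterior p (fst z) (snd z) / r z) \<partial>(lborel \<Otimes>\<^sub>M lborel))"
    using lborel_pair.integral_fst'[OF int] by simp
  finally show ?thesis by (simp add: K_def)
qed

end

section \<open>The difference of two expected information gains\<close>

lemma AE_lborel_fst:
  assumes "AE x in lborel. P x" and [measurable]: "Measurable.pred borel P"
  shows "AE z in (lborel :: 'a::euclidean_space measure) \<Otimes>\<^sub>M (lborel :: 'b::euclidean_space measure). P (fst z)"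
proof (rule lborel_pair.AE_pair_measure)
  show "{z \<in> space (lborel \<Otimes>\<^sub>M lborel). P (fst z)} \<in> sets (lborel \<Otimes>\<^sub>M lborel)" by measurable
qed (use assms in \<open>auto elim: eventually_mono\<close>)

lemma AE_lborel_snd:
  assumes "AE y in lborel. P y" and [measurable]: "Measurable.pred borel P"
  shows "AE z in (lborel :: 'a::euclidean_space measure) \<Otimes>\<^sub>M (lborel :: 'b::euclidean_space measure). P (snd z)"
proof (rule lborel_pair.AE_pair_measure)
  show "{z \<in> space (lborel \<Otimes>\<^sub>M lborel). P (snd z)} \<in> sets (lborel \<Otimes>\<^sub>M lborel)" by measurable
qed (use assms in auto)

text \<open>The comparison for two joint densities \<open>p\<close> and \<open>q\<close> with the same prior. The gain of \<open>q\<close> is the expectation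
under \<open>q\<close> of the log-likelihood ratio \<open>l = ln q - ln q\<^sub>d - ln \<pi>\<close>. If \<open>l\<close> has the same expectation under \<open>p\<close>, then
the gain difference is
\<open>E\<^sub>p [ln (p / (p\<^sub>d \<pi>))] - E\<^sub>p [ln (q / (q\<^sub>d \<pi>))] = E\<^sub>p [ln ((p / p\<^sub>d) / (q / q\<^sub>d))]\<close>,
the expected divergence of the posteriors, which is nonnegative by Gibbs' inequality. The integrand \<open>I1\<close> of
the gain of \<open>p\<close> is integrable because \<open>I1 + J\<close> is, with \<open>J\<close> the integrand of the divergence of \<open>p\<^sub>d\<close> from
\<open>q\<^sub>d\<close>, while both summands are bounded below by integrable functions.\<close>

theorem information_gain_difference:
  fixes p q :: "'d::euclidean_space \<times> 'p::euclidean_space \<Rightarrow> real" and \<pi> :: "'p \<Rightarrow> real"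
  defines "L \<equiv> lborel \<Otimes>\<^sub>M lborel"
  defines "qd \<equiv> data_marginal q"
  assumes p: "joint_density p" and q: "joint_density q"
    and prior_borel[measurable]: "\<pi> \<in> borel_measurable borel" and prior_pos: "\<And>m. 0 < \<pi> m"
    and p_prior: "AE m in lborel. param_marginal p m = \<pi> m"
    and q_prior: "AE m in lborel. param_marginal q m = \<pi> m"
    and q_pos: "AE z in L. 0 < q z" and qd_pos: "AE d in lborel. 0 < qd d"
    and ent: "integrable L (\<lambda>z. p z * ln (p z))"
    and ent_prior: "integrable L (\<lambda>z. p z * ln (\<pi> (snd z)))"
    and ent_qd: "integrable L (\<lambda>z. p z * ln (qd (fst z)))"
    and lp: "has_bochner_integral L (\<lambda>z. p z * (ln (q z) - ln (qd (fst z)) - ln (\<pi> (snd z)))) I"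
    and lq: "has_bochner_integral L (\<lambda>z. q z * (ln (q z) - ln (qd (fst z)) - ln (\<pi> (snd z)))) I"
  shows "expected_information_gain q \<le> expected_information_gain p"
    and "expected_information_gain p - expected_information_gain q
      = (\<integral>d. KL_dens (posterior p d) (posterior q d) \<partial>density lborel (data_marginal p))"
proof -
  interpret p: joint_density p by fact
  interpret q: joint_density q by fact
  have [measurable]: "qd \<in> borel_measurable borel" by (simp add: qd_def)
  define pd where "pd = data_marginal p"
  have [measurable]: "pd \<in> borel_measurable borel" by (simp add: pd_def)
  have borel_L[measurable_cong]: "sets L = sets (borel \<Otimes>\<^sub>M borel)" unfolding L_def by (rule sets_pair_measure_cong) simp_all
  have pm: "AE z in L. param_marginal p (snd z) = \<pi> (snd z)" unfolding L_def by (rule AE_lborel_snd[OF p_prior]) measurable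
  have qm: "AE z in L. param_marginal q (snd z) = \<pi> (snd z)" unfolding L_def by (rule AE_lborel_snd[OF q_prior]) measurable
  have qd_pos': "AE z in L. 0 < qd (fst z)" unfolding L_def by (rule AE_lborel_fst[OF qd_pos]) measurable
  have pf: "AE z in L. p z = pd (fst z) * posterior p (fst z) (snd z)"
    unfolding L_def pd_def by (rule p.AE_joint_data_marginal_times_posterior)
  have qf: "AE z in L. q z = qd (fst z) * posterior q (fst z) (snd z)"
    unfolding L_def qd_def by (rule q.AE_joint_data_marginal_times_posterior)
  have pd0: "0 \<le> pd d" for d by (simp add: pd_def p.data_marginal_nonneg)
  have qd0: "0 \<le> qd d" for d by (simp add: qd_def q.data_marginal_nonneg)

  define I1 where "I1 z = p z * ln (posterior p (fst z) (snd z) / param_marginal p (snd z))" for z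
  define J where "J z = p z * ln (pd (fst z) / qd (fst z))" for z
  \<comment> \<open>\<open>S1\<close>, \<open>S2\<close> and \<open>S3\<close> are the comparison densities \<open>s\<close> for which \<open>I1\<close>, \<open>J\<close> and \<open>I3\<close> are \<open>p * ln (p / s)\<close>.\<close>
  define S1 where "S1 z = pd (fst z) * param_marginal p (snd z)" for z
  define S2 where "S2 z = qd (fst z) * posterior p (fst z) (snd z)" for z
  define S3 where "S3 z = pd (fst z) * posterior q (fst z) (snd z)" for z
  define I3 where "I3 z = p z * ln (posterior p (fst z) (snd z) / posterior q (fst z) (snd z))" for z
  define l where "l z = ln (q z) - ln (qd (fst z)) - ln (\<pi> (snd z))" for z
  have [measurable]: "I1 \<in> borel_measurable L" "J \<in> borel_measurable L" "S1 \<in> borel_measurable L"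
    "S2 \<in> borel_measurable L" "S3 \<in> borel_measurable L" "I3 \<in> borel_measurable L" "l \<in> borel_measurable L"
    unfolding I1_def[abs_def] J_def[abs_def] S1_def[abs_def] S2_def[abs_def] S3_def[abs_def] I3_def[abs_def] l_def[abs_def]
    by measurable
  have S1: "integrable L S1"
    unfolding L_def
  proof (rule lborel_pair.Fubini_integrable)
    show "S1 \<in> borel_measurable (lborel \<Otimes>\<^sub>M lborel)"
      using \<open>S1 \<in> borel_measurable L\<close> by (simp add: L_def)
    show "integrable lborel (\<lambda>d. \<integral>m. norm (S1 (d, m)) \<partial>lborel)"
      using p.has_bochner_integral_data_marginal p.has_bochner_integral_param_marginal
      by (simp add: S1_def abs_mult pd_def p.data_marginal_nonneg p.param_marginal_nonneg has_bochner_integral_iff)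
    show "AE d in lborel. integrable lborel (\<lambda>m. S1 (d, m))"
      using p.has_bochner_integral_param_marginal by (simp add: S1_def has_bochner_integral_iff)
  qed
  have S2: "integrable L S2"
    unfolding L_def S2_def[abs_def]
    using q.has_bochner_integral_data_marginal qd0
    by (intro p.reweighted_posterior) (auto simp: qd_def has_bochner_integral_iff)
  have S3: "integrable L S3" "(\<integral>z. S3 z \<partial>L) \<le> 1"
    unfolding L_def S3_def[abs_def]
    using q.reweighted_posterior[of pd] p.has_bochner_integral_data_marginal pd0
    by (auto simp: pd_def has_bochner_integral_iff)
  have p_int: "integrable L p" "(\<integral>z. p z \<partial>L) = 1"
    using p.integrable_joint p.integral_joint by (simp_all add: L_def)

  have sum: "AE z in L. I1 z + J z = p z * ln (p z) - p z * ln (\<pi> (snd z)) - p z * ln (qd (fst z))"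
    using pf pm qd_pos'
  proof eventually_elim
    case (elim z)
    show ?case
    proof (cases "p z = 0")
      case False
      with elim p.nonneg[of z] pd0[of "fst z"] p.posterior_nonneg[of "fst z" "snd z"] prior_pos[of "snd z"]
      have pos: "0 < pd (fst z)" "0 < posterior p (fst z) (snd z)" by (auto simp: less_le)
      have lnp: "ln (p z) = ln (pd (fst z)) + ln (posterior p (fst z) (snd z))"
        using elim(1) pos by (simp add: ln_mult)
      show ?thesis
        unfolding I1_def J_def lnp using pos elim(2,3) prior_pos[of "snd z"] by (simp add: ln_div algebra_simps)
    qed (simp add: I1_def J_def)
  qed
  have "AE z in L. p z - S1 z \<le> I1 z"
    using pf pm
  proof eventually_elim
    case (elim z)
    have "p z * ln (p z / S1 z) = I1 z"
    proof (cases "pd (fst z) = 0")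
      case False
      then show ?thesis unfolding I1_def S1_def using elim(1) by simp
    qed (use elim(1) in \<open>simp add: I1_def\<close>)
    moreover have "p z - S1 z \<le> p z * ln (p z / S1 z)"
      using elim prior_pos[of "snd z"] p.nonneg[of z] pd0[of "fst z"]
      by (intro gibbs_pointwise) (auto simp: S1_def)
    ultimately show ?case by simp
  qed
  moreover have "AE z in L. p z - S2 z \<le> J z"
    using pf qd_pos'
  proof eventually_elim
    case (elim z)
    have "p z * ln (p z / S2 z) = J z"
    proof (cases "posterior p (fst z) (snd z) = 0")
      case False
      then show ?thesis unfolding J_def S2_def using elim(1) by simp
    qed (use elim(1) in \<open>simp add: J_def\<close>)
    moreover have "p z - S2 z \<le> p z * ln (p z / S2 z)"
      using elim p.nonneg[of z] qd0[of "fst z"] p.posterior_nonneg[of "fst z" "snd z"]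
      by (intro gibbs_pointwise) (auto simp: S2_def)
    ultimately show ?case by simp
  qed
  \<comment> \<open>Both \<open>I1 - (p - S1)\<close> and \<open>J - (p - S2)\<close> are nonnegative, so the first is at most their integrable sum.\<close>
  ultimately have bounds: "AE z in L. \<bar>I1 z - (p z - S1 z)\<bar>
      \<le> \<bar>p z * ln (p z) - p z * ln (\<pi> (snd z)) - p z * ln (qd (fst z)) - (p z - S1 z) - (p z - S2 z)\<bar>"
    using sum by eventually_elim auto
  have "integrable L (\<lambda>z. I1 z - (p z - S1 z))"
    by (rule Bochner_Integration.integrable_bound[where f="\<lambda>z. p z * ln (p z) - p z * ln (\<pi> (snd z)) - p z * ln (qd (fst z)) - (p z - S1 z) - (p z - S2 z)"])
      (use ent ent_prior ent_qd p_int S1 S2 bounds in auto)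
  from Bochner_Integration.integrable_add[OF this Bochner_Integration.integrable_diff[OF p_int(1) S1]]
  have I1: "integrable L I1" by simp

  have post_q: "AE z in L. 0 < posterior q (fst z) (snd z) \<and> ln (posterior q (fst z) (snd z)) = ln (q z) - ln (qd (fst z))"
    using qf q_pos qd_pos'
  proof eventually_elim
    case (elim z)
    then have "posterior q (fst z) (snd z) = q z / qd (fst z)" by simp
    with elim(2,3) show ?case by (simp add: ln_div)
  qed
  have I3_eq: "AE z in L. I3 z = I1 z - p z * l z"
    using pf pm post_q
  proof eventually_elim
    case (elim z)
    show ?case
    proof (cases "p z = 0")
      case False
      with elim(1) p.posterior_nonneg[of "fst z" "snd z"] have "0 < posterior p (fst z) (snd z)" by (auto simp: less_le)
      then have "I3 z = p z * (ln (posterior p (fst z) (snd z)) - ln (posterior q (fst z) (snd z)))"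
        "I1 z = p z * (ln (posterior p (fst z) (snd z)) - ln (\<pi> (snd z)))"
        using elim(2,3) prior_pos[of "snd z"] by (simp_all add: I3_def I1_def ln_div)
      moreover have "l z = ln (posterior q (fst z) (snd z)) - ln (\<pi> (snd z))"
        using elim(3) by (simp add: l_def)
      ultimately show ?thesis by (simp only: right_diff_distrib)
    qed (simp add: I3_def I1_def)
  qed
  have pl: "integrable L (\<lambda>z. p z * l z)" "(\<integral>z. p z * l z \<partial>L) = I"
    using lp by (simp_all add: l_def has_bochner_integral_iff)
  have ql: "integrable L (\<lambda>z. q z * l z)" "(\<integral>z. q z * l z \<partial>L) = I"
    using lq by (simp_all add: l_def has_bochner_integral_iff)
  have I3: "integrable L I3" "(\<integral>z. I3 z \<partial>L) = (\<integral>z. I1 z \<partial>L) - I"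
  proof -
    have "integrable L (\<lambda>z. I1 z - p z * l z)" using I1 pl by simp
    then show "integrable L I3" by (rule integrable_cong_AE[THEN iffD2, rotated 3]) (use I3_eq in auto)
    have "(\<integral>z. I3 z \<partial>L) = (\<integral>z. I1 z - p z * l z \<partial>L)" by (rule integral_cong_AE) (use I3_eq in auto)
    then show "(\<integral>z. I3 z \<partial>L) = (\<integral>z. I1 z \<partial>L) - I" using I1 pl by simp
  qed
  have "0 \<le> (\<integral>z. I3 z \<partial>L)"
  proof -
    have "AE z in L. p z - S3 z \<le> I3 z"
      using pf post_q
    proof eventually_elim
      case (elim z)
      have "p z * ln (p z / S3 z) = I3 z"
      proof (cases "pd (fst z) = 0")
        case False
        then show ?thesis unfolding I3_def S3_def using elim(1) by simp
      qed (use elim(1) in \<open>simp add: I3_def\<close>)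
      moreover have "p z - S3 z \<le> p z * ln (p z / S3 z)"
        using elim p.nonneg[of z] pd0[of "fst z"]
        by (intro gibbs_pointwise) (auto simp: S3_def)
      ultimately show ?case by simp
    qed
    then have "(\<integral>z. p z - S3 z \<partial>L) \<le> (\<integral>z. I3 z \<partial>L)"
      using p_int S3 I3 by (intro integral_mono_AE) auto
    then show ?thesis using p_int S3 by simp
  qed

  have pm_pos: "AE z in L. 0 < param_marginal p (snd z)" using pm by eventually_elim (simp add: prior_pos)
  have qm_pos: "AE z in L. 0 < param_marginal q (snd z)" using qm by eventually_elim (simp add: prior_pos)
  have post_q_pos: "AE z in L. 0 < posterior q (fst z) (snd z)" using post_q by eventually_elim auto
  have Psi_p: "expected_information_gain p = (\<integral>z. I1 z \<partial>L)"
    using I1 p.expected_KL_dens[of "\<lambda>z. param_marginal p (snd z)"] pm_pos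
    unfolding expected_information_gain_def I1_def[abs_def] L_def by (simp add: p.param_marginal_nonneg)
  have I2_eq: "AE z in L. q z * ln (posterior q (fst z) (snd z) / param_marginal q (snd z)) = q z * l z"
    using qm post_q by eventually_elim (simp add: l_def ln_div prior_pos less_imp_neq[OF prior_pos, symmetric])
  have I2: "integrable L (\<lambda>z. q z * ln (posterior q (fst z) (snd z) / param_marginal q (snd z)))"
    using ql(1) by (rule integrable_cong_AE[THEN iffD2, rotated 3]) (use I2_eq in auto)
  have "expected_information_gain q = (\<integral>z. q z * ln (posterior q (fst z) (snd z) / param_marginal q (snd z)) \<partial>L)"
    using I2 q.expected_KL_dens[of "\<lambda>z. param_marginal q (snd z)"] qm_pos
    unfolding expected_information_gain_def L_def by (simp add: q.param_marginal_nonneg)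
  also have "\<dots> = (\<integral>z. q z * l z \<partial>L)"
    by (rule integral_cong_AE) (use I2_eq in auto)
  finally have Psi_q: "expected_information_gain q = I" by (simp add: ql)
  have "(\<integral>d. KL_dens (posterior p d) (posterior q d) \<partial>density lborel (data_marginal p)) = (\<integral>z. I3 z \<partial>L)"
    using I3(1) p.expected_KL_dens[of "\<lambda>z. posterior q (fst z) (snd z)"] post_q_pos
    unfolding I3_def[abs_def] L_def by (simp add: q.posterior_nonneg)
  then show "expected_information_gain p - expected_information_gain q
      = (\<integral>d. KL_dens (posterior p d) (posterior q d) \<partial>density lborel (data_marginal p))"
    and "expected_information_gain q \<le> expected_information_gain p"
    using \<open>0 \<le> (\<integral>z. I3 z \<partial>L)\<close> by (simp_all add: I3(2) Psi_p Psi_q)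
qed

section \<open>The joint density of the linear Gaussian model\<close>

lemma gauss_density_eq_mode:
  "gauss_density \<mu> \<Gamma> x = gauss_density \<mu> \<Gamma> \<mu> * exp (- (1/2) * ((x - \<mu>) \<bullet> (matrix_inv \<Gamma> *v (x - \<mu>))))"
  by (simp add: gauss_density_def)

lemma ln_gauss_density:
  assumes "prob_space (gauss \<mu> \<Gamma>)"
  shows "ln (gauss_density \<mu> \<Gamma> x) = ln (gauss_density \<mu> \<Gamma> \<mu>) - (1/2) * ((x - \<mu>) \<bullet> (matrix_inv \<Gamma> *v (x - \<mu>)))"
  by (subst gauss_density_eq_mode) (use gauss_density_pos[OF assms, of \<mu>] in \<open>simp add: ln_mult\<close>)

lemma lborel_integral_translate:
  fixes f :: "'a::euclidean_space \<Rightarrow> real"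
  assumes [measurable]: "f \<in> borel_measurable borel"
  shows "(\<integral>x. f (x - a) \<partial>lborel) = (\<integral>x. f x \<partial>lborel)"
  using integral_distr[of "(+) (- a)" lborel borel f] by (simp add: lborel_distr_plus)

text \<open>The matrix \<open>H\<close> is \<open>A + transpose B ** C ** B\<close>, which is positive definite and hence invertible, and
\<open>K\<close> solves \<open>H ** K = transpose B ** C\<close>.\<close>

lemma complete_square:
  fixes A :: "real^'n^'n" and C :: "real^'k^'k" and B :: "real^'n^'k"
  assumes A: "spd A" and C: "spd C"
  obtains H K Q where "\<And>u v. u \<bullet> (A *v u) + (v - B *v u) \<bullet> (C *v (v - B *v u))
    = (u - K *v v) \<bullet> (H *v (u - K *v v)) + v \<bullet> (Q *v v)"
proof -
  define H where "H = A + transpose B ** C ** B"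
  have H: "x \<bullet> (H *v y) = x \<bullet> (A *v y) + (B *v x) \<bullet> (C *v (B *v y))" for x y
  proof -
    have "x \<bullet> (transpose B *v z) = (B *v x) \<bullet> z" for z
      using inner_matrix_adjoint[of x "transpose B" z] by (simp only: transpose_transpose)
    then show ?thesis
      unfolding H_def
      by (simp only: matrix_vector_mult_add_rdistrib inner_add_right matrix_vector_mul_assoc[symmetric])
  qed
  have "transpose H = H"
  proof -
    have "transpose (X + Y) = transpose X + transpose Y" for X Y :: "real^'n^'n"
      by (simp add: transpose_def vec_eq_iff)
    then show ?thesis using A C unfolding H_def spd_def by (simp add: matrix_transpose_mul matrix_mul_assoc)
  qed
  moreover have "x \<bullet> (H *v x) > 0" if "x \<noteq> 0" for x
  proof -
    have "0 \<le> (B *v x) \<bullet> (C *v (B *v x))"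
      using C by (cases "B *v x = 0") (auto simp: spd_def less_imp_le)
    then show ?thesis using A that by (simp add: H spd_def add_pos_nonneg)
  qed
  ultimately have spdH: "spd H" by (simp add: spd_def)
  define K where "K = matrix_inv H ** (transpose B ** C)"
  define Q where "Q = C - transpose K ** H ** K"
  have "u \<bullet> (A *v u) + (v - B *v u) \<bullet> (C *v (v - B *v u))
    = (u - K *v v) \<bullet> (H *v (u - K *v v)) + v \<bullet> (Q *v v)" for u v
  proof -
    have HK: "H *v (K *v v) = transpose B *v (C *v v)"
      by (simp only: K_def matrix_vector_mul_assoc[symmetric] spd_inv_cancel[OF spdH])
    have uHK: "u \<bullet> (H *v (K *v v)) = (B *v u) \<bullet> (C *v v)"
      unfolding HK inner_matrix_adjoint[of u] by (simp only: transpose_transpose)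
    have Q: "v \<bullet> (Q *v v) = v \<bullet> (C *v v) - (K *v v) \<bullet> (H *v (K *v v))"
    proof -
      have "v \<bullet> (transpose K *v z) = (K *v v) \<bullet> z" for z
        using inner_matrix_adjoint[of v "transpose K" z] by (simp only: transpose_transpose)
      then show ?thesis
        unfolding Q_def
        by (simp only: matrix_vector_mult_diff_rdistrib inner_diff_right matrix_vector_mul_assoc[symmetric])
    qed
    have "(u - K *v v) \<bullet> (H *v (u - K *v v)) = u \<bullet> (H *v u) - 2 * ((B *v u) \<bullet> (C *v v)) + (K *v v) \<bullet> (H *v (K *v v))"
      using spd_sym[OF spdH, of "K *v v" u]
      by (simp add: matrix_vector_mult_diff_distrib inner_diff_left inner_diff_right uHK)
    moreover have "(v - B *v u) \<bullet> (C *v (v - B *v u)) = v \<bullet> (C *v v) - 2 * ((B *v u) \<bullet> (C *v v)) + (B *v u) \<bullet> (C *v (B *v u))"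
      using spd_sym[OF C, of v "B *v u"]
      by (simp add: matrix_vector_mult_diff_distrib inner_diff_left inner_diff_right)
    ultimately show ?thesis by (simp add: Q H)
  qed
  then show ?thesis by (rule that)
qed

text \<open>After completing the square the parameter occurs only in a Gaussian factor centred at a point that
depends on the data. Its integral does not depend on that centre, so the data marginal is a constant times the
exponential of a quadratic form, and its logarithm is a quadratic polynomial.\<close>

lemma gaussian_data_marginal:
  fixes B :: "real^'n^'k" and mb :: "real^'n" and \<mu> :: "real^'k"
  assumes "spd Gm" "spd \<Gamma>"
  obtains c Q where "\<And>d. (\<integral>x. gauss_density mb Gm x * gauss_density \<mu> \<Gamma> (d - B *v x) \<partial>lborel)
    = c * exp (- (1/2) * ((d - (B *v mb + \<mu>)) \<bullet> (Q *v (d - (B *v mb + \<mu>)))))"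
proof -
  obtain H K Q where sq: "\<And>u v. u \<bullet> (matrix_inv Gm *v u) + (v - B *v u) \<bullet> (matrix_inv \<Gamma> *v (v - B *v u))
    = (u - K *v v) \<bullet> (H *v (u - K *v v)) + v \<bullet> (Q *v v)"
    using complete_square[OF spd_inv[OF assms(1)] spd_inv[OF assms(2)], of B] by metis
  define \<phi> where "\<phi> x = exp (- (1/2) * (x \<bullet> (H *v x)))" for x
  have [measurable]: "\<phi> \<in> borel_measurable borel" unfolding \<phi>_def[abs_def] by measurable
  define c0 where "c0 = gauss_density mb Gm mb * gauss_density \<mu> \<Gamma> \<mu>"
  have "(\<integral>x. gauss_density mb Gm x * gauss_density \<mu> \<Gamma> (d - B *v x) \<partial>lborel)
    = c0 * (\<integral>x. \<phi> x \<partial>lborel) * exp (- (1/2) * ((d - (B *v mb + \<mu>)) \<bullet> (Q *v (d - (B *v mb + \<mu>)))))" for d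
  proof -
    define v where "v = d - (B *v mb + \<mu>)"
    have "gauss_density mb Gm x * gauss_density \<mu> \<Gamma> (d - B *v x)
      = c0 * exp (- (1/2) * (v \<bullet> (Q *v v))) * \<phi> (x - (mb + K *v v))" for x
    proof -
      have 1: "d - B *v x - \<mu> = v - B *v (x - mb)"
        by (simp add: v_def matrix_vector_mult_diff_distrib)
      have 2: "x - (mb + K *v v) = x - mb - K *v v" by simp
      have "exp (- (1/2) * ((x - mb) \<bullet> (matrix_inv Gm *v (x - mb))))
          * exp (- (1/2) * ((v - B *v (x - mb)) \<bullet> (matrix_inv \<Gamma> *v (v - B *v (x - mb)))))
        = exp (- (1/2) * (v \<bullet> (Q *v v))) * \<phi> (x - mb - K *v v)"
        unfolding \<phi>_def exp_add[symmetric] using sq[of "x - mb" v] by (simp add: algebra_simps)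
      then show ?thesis
        unfolding gauss_density_eq_mode[of mb Gm x] gauss_density_eq_mode[of \<mu> \<Gamma> "d - B *v x"] 1 2 c0_def
        by (simp add: ac_simps)
    qed
    then show ?thesis
      using lborel_integral_translate[of \<phi> "mb + K *v v"] by (simp add: v_def[symmetric])
  qed
  then show ?thesis by (rule that)
qed

lemma joint_density_of_distributed:
  fixes p :: "'d::euclidean_space \<times> 'p::euclidean_space \<Rightarrow> real"
  assumes M: "prob_space M" and X: "distributed M lborel X p" and p: "\<And>z. 0 \<le> p z"
  shows "joint_density p"
proof
  interpret prob_space M by fact
  have m: "p \<in> borel_measurable borel" using distributed_real_measurable[OF _ X] p by simp
  then show "p \<in> borel_measurable (borel \<Otimes>\<^sub>M borel)" by (subst borel_prod)
  show "has_bochner_integral (lborel \<Otimes>\<^sub>M lborel) p 1"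
    using distributed_integral[OF X, of "\<lambda>_. 1"] distributed_integrable[OF X, of "\<lambda>_. 1"] p
    by (simp add: has_bochner_integral_iff lborel_prod prob_space)
qed (rule p)

lemma has_bochner_integral_joint_density:
  fixes p :: "'d::euclidean_space \<times> 'p::euclidean_space \<Rightarrow> real" and f :: "'d \<times> 'p \<Rightarrow> real"
  assumes X: "distributed M lborel X p" and p: "\<And>z. 0 \<le> p z"
    and f: "f \<in> borel_measurable (borel \<Otimes>\<^sub>M borel)"
    and I: "has_bochner_integral M (\<lambda>w. f (X w)) I"
  shows "has_bochner_integral (lborel \<Otimes>\<^sub>M lborel) (\<lambda>z. p z * f z) I"
proof -
  have "f \<in> borel_measurable borel" using f by (subst (asm) borel_prod)
  then show ?thesis
    using distributed_integral[OF X, of f] distributed_integrable[OF X, of f] p I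
    by (simp add: has_bochner_integral_iff lborel_prod)
qed

text \<open>Almost everywhere the section of \<open>p\<close> is integrable, and there the Bochner integral that defines
\<open>param_marginal\<close> agrees with the nonnegative integral that gives the density of \<open>Y\<close>.\<close>

lemma AE_param_marginal:
  fixes p :: "'d::euclidean_space \<times> 'p::euclidean_space \<Rightarrow> real"
  assumes M: "prob_space M" and X: "distributed M lborel (\<lambda>w. (D w, Y w)) p" and p: "\<And>z. 0 \<le> p z"
    and Y: "distributed M lborel Y \<pi>" and \<pi>: "\<And>y. 0 \<le> \<pi> y"
  shows "AE y in lborel. param_marginal p y = \<pi> y"
proof -
  interpret prob_space M by fact
  interpret joint_density p by (rule joint_density_of_distributed[OF M X p])
  have "distributed M (lborel \<Otimes>\<^sub>M lborel) (\<lambda>w. (D w, Y w)) p" using X by (simp add: lborel_prod)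
  then have "distributed M lborel Y (\<lambda>y. \<integral>\<^sup>+d. p (d, y) \<partial>lborel)"
    by (intro distr_marginal2) (auto intro: lborel.sigma_finite_measure_axioms)
  then have "AE y in lborel. (\<integral>\<^sup>+d. p (d, y) \<partial>lborel) = \<pi> y"
    using Y by (rule distributed_unique)
  moreover have "AE y in lborel. integrable lborel (\<lambda>d. p (d, y))"
    using lborel_pair.AE_integrable_snd[of "\<lambda>x y. p (x, y)"] integrable_joint by simp
  ultimately show ?thesis
  proof eventually_elim
    case (elim y)
    then have "ennreal (param_marginal p y) = ennreal (\<pi> y)"
      unfolding param_marginal_def by (simp add: nn_integral_eq_integral p)
    then show ?case using param_marginal_nonneg[of y] \<pi>[of y] by simp
  qed
qed

section \<open>Comparison of the accurate and the linear model\<close>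

text \<open>The three quadratic forms that make up the log-densities of prior, likelihood and data marginal of the
linear model. Their expectations are functions of the second moments in the hypothesis, hence
the same in every model that shares these moments. For the last one, \<open>D - (B *v mb + \<mu>)\<close> is the sum of the
residual \<open>D - B *v m - \<mu>\<close> and \<open>B *v (m - mb)\<close>.\<close>

lemma gaussian_model_log_terms:
  fixes B :: "real^'n^'k" and \<Gamma> Q :: "real^'k^'k" and D :: "'w \<Rightarrow> real^'k" and m :: "'w \<Rightarrow> real^'n"
  assumes moments: "\<And>k l. has_bochner_integral N
      (\<lambda>w. (k \<bullet> (D w - B *v m w - \<mu>) + l \<bullet> (m w - mb))\<^sup>2) (k \<bullet> (\<Gamma> *v k) + l \<bullet> (Gm *v l))"
  shows "has_bochner_integral N (\<lambda>w. (D w - B *v m w - \<mu>) \<bullet> (C *v (D w - B *v m w - \<mu>)))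
      (quadratic_form_mean C (\<lambda>k. k \<bullet> (\<Gamma> *v k)))"
    and "has_bochner_integral N (\<lambda>w. (m w - mb) \<bullet> (A *v (m w - mb)))
      (quadratic_form_mean A (\<lambda>l. l \<bullet> (Gm *v l)))"
    and "has_bochner_integral N (\<lambda>w. (D w - (B *v mb + \<mu>)) \<bullet> (Q *v (D w - (B *v mb + \<mu>))))
      (quadratic_form_mean Q (\<lambda>k. k \<bullet> (\<Gamma> *v k) + (transpose B *v k) \<bullet> (Gm *v (transpose B *v k))))"
proof -
  show "has_bochner_integral N (\<lambda>w. (D w - B *v m w - \<mu>) \<bullet> (C *v (D w - B *v m w - \<mu>)))
      (quadratic_form_mean C (\<lambda>k. k \<bullet> (\<Gamma> *v k)))"
    by (rule has_bochner_integral_quadratic_form) (use moments[of _ 0] in simp)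
  show "has_bochner_integral N (\<lambda>w. (m w - mb) \<bullet> (A *v (m w - mb)))
      (quadratic_form_mean A (\<lambda>l. l \<bullet> (Gm *v l)))"
    by (rule has_bochner_integral_quadratic_form) (use moments[of 0] in simp)
  show "has_bochner_integral N (\<lambda>w. (D w - (B *v mb + \<mu>)) \<bullet> (Q *v (D w - (B *v mb + \<mu>))))
      (quadratic_form_mean Q (\<lambda>k. k \<bullet> (\<Gamma> *v k) + (transpose B *v k) \<bullet> (Gm *v (transpose B *v k))))"
  proof (rule has_bochner_integral_quadratic_form)
    fix k
    have "k \<bullet> (D w - (B *v mb + \<mu>)) = k \<bullet> (D w - B *v m w - \<mu>) + (transpose B *v k) \<bullet> (m w - mb)" for w
      unfolding inner_matrix_adjoint[symmetric]
      by (simp add: matrix_vector_mult_diff_distrib inner_diff_right inner_add_right)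
    then show "has_bochner_integral N (\<lambda>w. (k \<bullet> (D w - (B *v mb + \<mu>)))\<^sup>2)
        (k \<bullet> (\<Gamma> *v k) + (transpose B *v k) \<bullet> (Gm *v (transpose B *v k)))"
      using moments[of k "transpose B *v k"] by simp
  qed
qed

theorem theorem4p5:
  fixes F :: "real^'n \<Rightarrow> real^'k"
    and mb :: "real^'n" and Gm :: "real^'n^'n"
    and eb :: "real^'k" and Ge :: "real^'k^'k"
    and M :: "'w measure" and m :: "'w \<Rightarrow> real^'n" and e :: "'w \<Rightarrow> real^'k"
    and M\<^sub>O :: "'v measure" and m\<^sub>O :: "'v \<Rightarrow> real^'n" and eta :: "'v \<Rightarrow> real^'k"
    and p p\<^sub>O :: "(real^'k) \<times> (real^'n) \<Rightarrow> real"
  assumes "spd Gm" and "spd Ge"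
    and "F \<in> borel_measurable borel"
    and "integrable (gauss mb Gm) (\<lambda>x. (norm (F x))\<^sup>2)"
    (* accurate model, with joint density p *)
    and "prob_space M"
    and "distributed M lborel m (gauss_density mb Gm)"
    and "distributed M lborel e (gauss_density eb Ge)"
    and "indep_rv M m e"
    and "distributed M lborel (\<lambda>w. (F (m w) + e w, m w)) p"
    and "\<And>z. 0 \<le> p z"
    (* finite differential entropy, with natural logarithm *)
    and "information_space.finite_entropy M (exp 1) lborel (\<lambda>w. (F (m w) + e w, m w)) p"
    (* pure-BAE global linear model, with joint density p\<^sub>O *)
    and "prob_space M\<^sub>O"
    and "distributed M\<^sub>O lborel m\<^sub>O (gauss_density mb Gm)"
    and "distributed M\<^sub>O lborel eta (gauss_density (bae_mean F mb Gm eb) (bae_cov F mb Gm Ge))"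
    and "indep_rv M\<^sub>O m\<^sub>O eta"
    and "distributed M\<^sub>O lborel (\<lambda>w. (bae_op F mb Gm *v m\<^sub>O w + eta w, m\<^sub>O w)) p\<^sub>O"
    and "\<And>z. 0 \<le> p\<^sub>O z"
  shows "expected_information_gain p \<ge> expected_information_gain p\<^sub>O
    \<and> expected_information_gain p - expected_information_gain p\<^sub>O
        = (\<integral>d. KL_dens (posterior p d) (posterior p\<^sub>O d) \<partial>density lborel (data_marginal p))"
proof -
  let ?B = "bae_op F mb Gm" and ?\<mu> = "bae_mean F mb Gm eb" and ?\<Gamma> = "bae_cov F mb Gm Ge"
  let ?\<pi> = "gauss_density mb Gm" and ?\<nu> = "gauss_density ?\<mu> ?\<Gamma>"
  let ?L = "lborel \<Otimes>\<^sub>M lborel :: ((real^'k) \<times> (real^'n)) measure"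
  note F = assms(3) and L2 = assms(4) and M = assms(5) and m = assms(6) and e = assms(7) and ind = assms(8)
    and D = assms(9) and p0 = assms(10) and ent = assms(11) and MO = assms(12) and mO = assms(13)
    and eta = assms(14) and indO = assms(15) and DO = assms(16) and q0 = assms(17)
  have P\<pi>: "prob_space (gauss mb Gm)" and P\<nu>: "prob_space (gauss ?\<mu> ?\<Gamma>)"
    using prob_space_gauss_of_distributed M m MO eta by blast+
  have spd\<Gamma>: "spd ?\<Gamma>" by (rule spd_bae_cov[OF assms(1,2) P\<pi> F L2])
  interpret p: joint_density p by (rule joint_density_of_distributed[OF M D p0])
  interpret q: joint_density p\<^sub>O by (rule joint_density_of_distributed[OF MO DO q0])
  have \<pi>0: "0 < ?\<pi> x" and \<nu>0: "0 < ?\<nu> y" for x y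
    using gauss_density_pos P\<pi> P\<nu> by blast+

  have q_eq: "AE z in ?L. p\<^sub>O z = ?\<pi> (snd z) * ?\<nu> (fst z - ?B *v snd z)"
  proof -
    have "distributed M\<^sub>O lborel (\<lambda>w. (?B *v m\<^sub>O w + eta w, m\<^sub>O w))
        (\<lambda>z. ennreal (?\<pi> (snd z)) * ennreal (?\<nu> (fst z - ?B *v snd z)))"
      by (rule distributed_shifted_noise[OF MO indO mO eta]) simp
    from prob_space.distributed_unique[OF MO DO this]
    have "AE z in ?L. ennreal (p\<^sub>O z) = ennreal (?\<pi> (snd z)) * ennreal (?\<nu> (fst z - ?B *v snd z))"
      unfolding lborel_prod .
    then show ?thesis
      by eventually_elim (simp add: ennreal_mult[symmetric] less_imp_le[OF \<pi>0] less_imp_le[OF \<nu>0] q0)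
  qed
  obtain c Q where cQ: "\<And>d. (\<integral>x. ?\<pi> x * ?\<nu> (d - ?B *v x) \<partial>lborel)
      = c * exp (- (1/2) * ((d - (?B *v mb + ?\<mu>)) \<bullet> (Q *v (d - (?B *v mb + ?\<mu>)))))"
    by (rule gaussian_data_marginal[OF assms(1) spd\<Gamma>, of mb ?\<mu> ?B]) blast
  define W where "W z = fst z - ?B *v snd z - ?\<mu>" for z
  define V where "V d = d - (?B *v mb + ?\<mu>)" for d
  have [measurable]: "W \<in> borel_measurable (borel \<Otimes>\<^sub>M borel)" "V \<in> borel_measurable borel"
    unfolding W_def[abs_def] V_def[abs_def] by measurable
  have qd: "AE d in lborel. data_marginal p\<^sub>O d = c * exp (- (1/2) * (V d \<bullet> (Q *v V d)))"
    using lborel_pair.AE_pair[OF q_eq]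
  proof eventually_elim
    case (elim d)
    then have "data_marginal p\<^sub>O d = (\<integral>x. ?\<pi> x * ?\<nu> (d - ?B *v x) \<partial>lborel)"
      unfolding data_marginal_def by (intro integral_cong_AE) auto
    then show ?case by (simp add: cQ V_def)
  qed
  \<comment> \<open>If \<open>c\<close> were not positive, the data marginal would vanish almost everywhere and not have mass one.\<close>
  have c: "0 < c"
  proof (rule ccontr)
    assume "\<not> 0 < c"
    have "AE d in lborel. data_marginal p\<^sub>O d = 0"
      using qd
    proof eventually_elim
      case (elim d)
      then have "data_marginal p\<^sub>O d \<le> 0" using \<open>\<not> 0 < c\<close> by (simp add: mult_nonpos_nonneg)
      then show ?case using q.data_marginal_nonneg[of d] by simp
    qed
    then have "(\<integral>d. data_marginal p\<^sub>O d \<partial>lborel) = 0" by (rule integral_eq_zero_AE)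
    then show False using q.has_bochner_integral_data_marginal by (simp add: has_bochner_integral_iff)
  qed
  have qd_ln: "AE d in lborel. ln (data_marginal p\<^sub>O d) = ln c - (1/2) * (V d \<bullet> (Q *v V d))"
    using qd
  proof eventually_elim
    case (elim d)
    show ?case unfolding elim using c by (subst ln_mult) simp_all
  qed
  have qd_ln_L: "AE z in ?L. ln (data_marginal p\<^sub>O (fst z)) = ln c - (1/2) * (V (fst z) \<bullet> (Q *v V (fst z)))"
    by (rule AE_lborel_fst[OF qd_ln]) measurable

  \<comment> \<open>Almost everywhere \<open>l\<close> is the log-likelihood ratio of the linear model, here written out as a quadratic polynomial.\<close>
  define l where "l z = ln (?\<nu> ?\<mu>) - (1/2) * (W z \<bullet> (matrix_inv ?\<Gamma> *v W z)) - (ln c - (1/2) * (V (fst z) \<bullet> (Q *v V (fst z))))" for z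
  have l_eq: "AE z in ?L. ln (p\<^sub>O z) - ln (data_marginal p\<^sub>O (fst z)) - ln (?\<pi> (snd z)) = l z"
    using q_eq qd_ln_L
  proof eventually_elim
    case (elim z)
    have "ln (p\<^sub>O z) = ln (?\<pi> (snd z)) + ln (?\<nu> (fst z - ?B *v snd z))"
      unfolding elim(1) by (rule ln_mult_pos[OF \<pi>0 \<nu>0])
    then show ?case
      unfolding elim(2) l_def W_def using ln_gauss_density[OF P\<nu>, of "fst z - ?B *v snd z"] by simp
  qed
  have [measurable]: "l \<in> borel_measurable (borel \<Otimes>\<^sub>M borel)"
    unfolding l_def[abs_def] by measurable

  have mom: "has_bochner_integral M
      (\<lambda>w. (k \<bullet> (F (m w) + e w - ?B *v m w - ?\<mu>) + j \<bullet> (m w - mb))\<^sup>2) (k \<bullet> (?\<Gamma> *v k) + j \<bullet> (Gm *v j))" for k j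
    by (rule accurate_model_second_moments[OF assms(1,2) F L2 M m e ind])
  have momO: "has_bochner_integral M\<^sub>O
      (\<lambda>w. (k \<bullet> (?B *v m\<^sub>O w + eta w - ?B *v m\<^sub>O w - ?\<mu>) + j \<bullet> (m\<^sub>O w - mb))\<^sup>2) (k \<bullet> (?\<Gamma> *v k) + j \<bullet> (Gm *v j))" for k j
    by (rule linear_model_second_moments[OF assms(1) spd\<Gamma> MO mO eta indO])
  note terms = gaussian_model_log_terms[where D="\<lambda>w. F (m w) + e w" and m=m, OF mom]
  note termsO = gaussian_model_log_terms[where D="\<lambda>w. ?B *v m\<^sub>O w + eta w" and m=m\<^sub>O, OF momO]
  have const: "has_bochner_integral N (\<lambda>_. a) a" if "prob_space N" for N :: "'z measure" and a :: real
    using that by (simp add: has_bochner_integral_iff prob_space.prob_space prob_space.finite_measure finite_measure.integrable_const)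
  \<comment> \<open>The common expectation of \<open>l\<close> in the two models.\<close>
  define I where "I = ln (?\<nu> ?\<mu>) - (1/2) * quadratic_form_mean (matrix_inv ?\<Gamma>) (\<lambda>k. k \<bullet> (?\<Gamma> *v k))
    - (ln c - (1/2) * quadratic_form_mean Q (\<lambda>k. k \<bullet> (?\<Gamma> *v k) + (transpose ?B *v k) \<bullet> (Gm *v (transpose ?B *v k))))"
  have "has_bochner_integral M (\<lambda>w. l (F (m w) + e w, m w)) I"
    unfolding l_def W_def V_def I_def fst_conv snd_conv
    by (intro has_bochner_integral_diff has_bochner_integral_mult_right const M terms)
  then have lp: "has_bochner_integral ?L (\<lambda>z. p z * l z) I"
    by (intro has_bochner_integral_joint_density[OF D p0]) simp_all
  have "has_bochner_integral M\<^sub>O (\<lambda>w. l (?B *v m\<^sub>O w + eta w, m\<^sub>O w)) I"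
    unfolding l_def W_def V_def I_def fst_conv snd_conv
    by (intro has_bochner_integral_diff has_bochner_integral_mult_right const MO termsO)
  then have lq: "has_bochner_integral ?L (\<lambda>z. p\<^sub>O z * l z) I"
    by (intro has_bochner_integral_joint_density[OF DO q0]) simp_all

  have ent': "integrable ?L (\<lambda>z. p z * ln (p z))"
  proof -
    have "information_space M (exp 1)"
      using M by (simp add: information_space_def information_space_axioms_def)
    from information_space.finite_entropy_integrable[OF this ent] show ?thesis
      by (simp add: lborel_prod log_def)
  qed
  have ent_prior: "integrable ?L (\<lambda>z. p z * ln (?\<pi> (snd z)))"
  proof -
    have "has_bochner_integral M (\<lambda>w. ln (?\<pi> (snd (F (m w) + e w, m w))))
        (ln (?\<pi> mb) - (1/2) * quadratic_form_mean (matrix_inv Gm) (\<lambda>k. k \<bullet> (Gm *v k)))"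
      unfolding snd_conv ln_gauss_density[OF P\<pi>, of "m _"]
      by (intro has_bochner_integral_diff has_bochner_integral_mult_right const M terms)
    from has_bochner_integral_joint_density[OF D p0 _ this] show ?thesis
      by (simp add: has_bochner_integral_iff)
  qed
  have ent_qd: "integrable ?L (\<lambda>z. p z * ln (data_marginal p\<^sub>O (fst z)))"
  proof -
    have "has_bochner_integral M (\<lambda>w. ln c - (1/2) * (V (fst (F (m w) + e w, m w)) \<bullet> (Q *v V (fst (F (m w) + e w, m w)))))
        (ln c - (1/2) * quadratic_form_mean Q (\<lambda>k. k \<bullet> (?\<Gamma> *v k) + (transpose ?B *v k) \<bullet> (Gm *v (transpose ?B *v k))))"
      unfolding V_def fst_conv
      by (intro has_bochner_integral_diff has_bochner_integral_mult_right const M terms)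
    from has_bochner_integral_joint_density[OF D p0 _ this]
    have "integrable ?L (\<lambda>z. p z * (ln c - (1/2) * (V (fst z) \<bullet> (Q *v V (fst z)))))"
      by (simp add: has_bochner_integral_iff)
    then show ?thesis
      by (rule integrable_cong_AE[THEN iffD2, rotated 3]) (use qd_ln_L in auto)
  qed
  have swap: "has_bochner_integral ?L (\<lambda>z. f z * (ln (p\<^sub>O z) - ln (data_marginal p\<^sub>O (fst z)) - ln (?\<pi> (snd z)))) I"
    if "has_bochner_integral ?L (\<lambda>z. f z * l z) I" and [measurable]: "f \<in> borel_measurable (borel \<Otimes>\<^sub>M borel)" for f
    by (rule has_bochner_integral_cong_AE[THEN iffD2, OF _ _ _ that(1)]) (use l_eq in \<open>auto elim: eventually_mono\<close>)

  have q_pos: "AE z in ?L. 0 < p\<^sub>O z" using q_eq by eventually_elim (simp add: \<pi>0 \<nu>0)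
  have qd_pos: "AE d in lborel. 0 < data_marginal p\<^sub>O d" using qd by eventually_elim (simp add: c)
  have p_prior: "AE x in lborel. param_marginal p x = ?\<pi> x"
    by (rule AE_param_marginal[OF M D p0 m]) (rule less_imp_le[OF \<pi>0])
  have q_prior: "AE x in lborel. param_marginal p\<^sub>O x = ?\<pi> x"
    by (rule AE_param_marginal[OF MO DO q0 mO]) (rule less_imp_le[OF \<pi>0])
  note * = information_gain_difference[OF p.joint_density_axioms q.joint_density_axioms borel_measurable_gauss_density
    \<pi>0 p_prior q_prior q_pos qd_pos ent' ent_prior ent_qd swap[OF lp p.borel] swap[OF lq q.borel]]
  show ?thesis using * by blast
qed

end
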